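(* Let $B = (B_t)_{t\ge 0}$ and $W = (W_t)_{t \ge 0}$ be independent standard Brownian motions on $\mathbb{R}$ (both started at $0$), and let $\sigma, c > 0$ be real constants. Define $\tau$ to be the first time when $B$ hits the barrier $c + \sigma W$, i.e. $$\tau := \inf\{t \ge 0 \mid B_t = c + \sigma W_t\}.$$ Then, conditionally on $W$, the distribution of $\tau$ is almost surely singular to the Lebesgue measure. That is, if $D(\omega, dt)$ denotes a regular conditional distribution of $\tau$ given $\sigma(W)$, then for $\mathbb{P}$-almost every $\omega$ the probability measure $D(\omega, \cdot)$ on $\mathbb{R}$ is mutually singular with the Lebesgue measure on $\mathbb{R}$.
   Context: $\sigma(W)$ denotes the $\sigma$-algebra generated by the process $W$ (not to be confused with the constant $\sigma>0$). The time $\tau$ is almost surely finite, so its conditional distribution given $W$ is almost surely a probability measure on $\mathbb{R}$ (supported on $[0,\infty)$). Two measures $\mu,\nu$ on $\mathbb{R}$ are (mutually) singular if there is a Borel set $A$ with $\mu(\mathbb{R}\setminus A)=0$ and $\nu(A)=0$. *)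

theory Defs
  imports "HOL-Probability.Probability"
begin

text \<open>
  Processes are indexed by all reals, but only the values at times \<open>t \<ge> 0\<close> are ever used.
\<close>

definition std_brownian_motion :: "'a measure \<Rightarrow> (real \<Rightarrow> 'a \<Rightarrow> real) \<Rightarrow> bool" where
  "std_brownian_motion M B \<longleftrightarrow>
     (\<forall>t\<ge>0. B t \<in> borel_measurable M) \<and>
     (AE \<omega> in M. B 0 \<omega> = 0) \<and>
     (\<forall>(n::nat) (t::nat \<Rightarrow> real).
        0 \<le> t 0 \<longrightarrow> (\<forall>i<n. t i \<le> t (Suc i)) \<longrightarrow>
        prob_space.indep_vars M (\<lambda>_. borel) (\<lambda>i \<omega>. B (t (Suc i)) \<omega> - B (t i) \<omega>) {..<n}) \<and>
     (\<forall>s t. 0 \<le> s \<longrightarrow> s < t \<longrightarrow>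
        distributed M lborel (\<lambda>\<omega>. B t \<omega> - B s \<omega>) (normal_density 0 (sqrt (t - s)))) \<and>
     (AE \<omega> in M. continuous_on {0..} (\<lambda>t. B t \<omega>))"

definition process_sigma :: "'a measure \<Rightarrow> (real \<Rightarrow> 'a \<Rightarrow> real) \<Rightarrow> 'a measure" where
  "process_sigma M X =
     sigma (space M) (\<Union>t\<in>{0..}. {X t -` A \<inter> space M | A. A \<in> sets borel})"

definition indep_processes ::
    "'a measure \<Rightarrow> (real \<Rightarrow> 'a \<Rightarrow> real) \<Rightarrow> (real \<Rightarrow> 'a \<Rightarrow> real) \<Rightarrow> bool" where
  "indep_processes M X Y \<longleftrightarrow>
     prob_space.indep_set M (sets (process_sigma M X)) (sets (process_sigma M Y))"

text \<open>The value is \<open>\<infinity>\<close> on paths that never hit the barrier.\<close>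

definition hitting_time ::
    "(real \<Rightarrow> 'a \<Rightarrow> real) \<Rightarrow> (real \<Rightarrow> 'a \<Rightarrow> real) \<Rightarrow> real \<Rightarrow> real \<Rightarrow> 'a \<Rightarrow> ereal" where
  "hitting_time B W c \<sigma> \<omega> = Inf {ereal t | t. 0 \<le> t \<and> B t \<omega> = c + \<sigma> * W t \<omega>}"

text \<open>
  Regular conditional distribution on the real line, given the sub-\<open>\<sigma>\<close>-algebra \<open>F\<close>, of an
  extended-real random variable that is almost surely finite. Such a \<open>D\<close> is an \<open>F\<close>-measurable
  probability kernel. For \<open>A = UNIV\<close> the last clause forces \<open>T\<close> to be almost surely finite.
\<close>

definition regular_cond_distr ::
    "'a measure \<Rightarrow> 'a measure \<Rightarrow> ('a \<Rightarrow> ereal) \<Rightarrow> ('a \<Rightarrow> real measure) \<Rightarrow> bool" where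
  "regular_cond_distr M F T D \<longleftrightarrow>
     subalgebra M F \<and>
     T \<in> borel_measurable M \<and>
     D \<in> measurable F (prob_algebra borel) \<and>
     (\<forall>A\<in>sets borel. AE \<omega> in M.
        measure (D \<omega>) A = real_cond_exp M F (indicator {\<omega>' \<in> space M. T \<omega>' \<in> ereal ` A}) \<omega>)"

definition mutually_singular :: "real measure \<Rightarrow> real measure \<Rightarrow> bool" where
  "mutually_singular \<mu> \<nu> \<longleftrightarrow>
     (\<exists>A\<in>sets borel. emeasure \<mu> (UNIV - A) = 0 \<and> emeasure \<nu> A = 0)"

end

theory Submission
  imports Defs
begin

text \<open>
  Put \<open>\<kappa> = sqrt (1 + \<sigma>\<^sup>2)\<close>. The rotated processes \<open>Y = (\<sigma> B + W) / \<kappa>\<close> and \<open>Z = (B - \<sigma> W) / \<kappa>\<close> are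
  again independent standard Brownian motions, and \<open>W = (Y - \<sigma> Z) / \<kappa>\<close>. The barrier condition
  \<open>B t = c + \<sigma> W t\<close> reads \<open>Z t = b\<close> with \<open>b = c / \<kappa>\<close>, so \<open>\<tau>\<close> is the first passage time of \<open>Z\<close> at \<open>b\<close>.
  Hence \<open>\<tau>\<close> is independent of \<open>Y\<close>, whereas \<open>Z\<close> stays below \<open>b\<close> before \<open>\<tau>\<close>. Looking back from \<open>\<tau>\<close>,
  \<open>W (\<tau> - s) - W \<tau> = ((Y (\<tau> - s) - Y \<tau>) + \<sigma> (b - Z (\<tau> - s))) / \<kappa>\<close>
  is Brownian noise plus a positive term of order \<open>sqrt s\<close> on all small scales \<open>s\<close>. Looking back
  from a fixed time \<open>t > 0\<close>, the path of \<open>W\<close> shows only noise. So the path of \<open>W\<close> alone distinguishes \<open>\<tau>\<close>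
  from a typical time.

  The two cases are told apart by averaging \<open>(W (t - s) - W t) / sqrt s\<close> over \<open>N\<close> roughly
  geometrically spaced scales \<open>s\<close>. The noise on different scales is almost uncorrelated, so its average has second
  moment at most \<open>5 / N\<close> (\<open>scale_sum_second_moment\<close>). With \<open>N = (m + 1) ^ 4\<close> scales in the \<open>m\<close>-th
  average, Borel-Cantelli makes the noise average eventually smaller than any multiple of
  \<open>1 / (m + 1)\<close>, both for \<open>W\<close> at a fixed time and for \<open>Y\<close> at the time \<open>\<tau>\<close> that is independent of it
  (\<open>scale_averages_vanish_at_independent_time\<close>).

  It remains to see that \<open>b - Z (\<tau> - s)\<close> is rarely much smaller than \<open>sqrt s\<close>. If \<open>Z\<close> is within
  distance \<open>a\<close> of \<open>b\<close> at a time \<open>u < \<tau>\<close>, then with at least a fixed probability \<open>p0\<close> it crosses \<open>b\<close>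
  by time \<open>u + a\<^sup>2\<close>. As \<open>{u. u < \<tau> \<and> \<tau> \<le> u + a\<^sup>2}\<close> has length \<open>a\<^sup>2\<close>, integrating over \<open>u\<close> bounds the expected
  time that \<open>Z\<close> spends within \<open>a\<close> of \<open>b\<close> before \<open>\<tau>\<close> by \<open>a\<^sup>2 / p0\<close> (\<open>occupation_before_passage\<close>).
  Therefore in each interval \<open>[r, 2 r]\<close> there is a scale \<open>s\<close> with
  \<open>b - Z (\<tau> - s) > sqrt s / (m + 1)\<close> up to probability of order \<open>1 / (m + 1)\<^sup>2\<close>, and the
  contribution of \<open>Z\<close> to the average is eventually at least of order \<open>1 / (m + 1)\<close>
  (\<open>exists_scales_negative_average_at_passage\<close>).

  The times at which the averages of \<open>W\<close> are eventually at least \<open>\<epsilon> / (m + 1)\<close> thus form, for almost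
  every path, a Lebesgue null set by Fubini. They include \<open>\<tau>\<close> almost surely, so the conditional law
  of \<open>\<tau>\<close> is carried by this null set (\<open>AE_regular_cond_distr\<close>).
\<close>

section \<open>Evaluating paths along dyadic times\<close>

definition dyadic_floor :: "nat \<Rightarrow> real \<Rightarrow> real" where
  "dyadic_floor n t = real (nat \<lfloor>2 ^ n * t\<rfloor>) / 2 ^ n"

lemma dyadic_floor_nonneg [simp]: "0 \<le> dyadic_floor n t"
  by (simp add: dyadic_floor_def)

lemma dyadic_floor_le: "0 \<le> t \<Longrightarrow> dyadic_floor n t \<le> t"
  unfolding dyadic_floor_def by (simp add: field_simps)

lemma dyadic_floor_tendsto:
  assumes "0 \<le> t"
  shows "(\<lambda>n. dyadic_floor n t) \<longlonglongrightarrow> t"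
proof (rule real_tendsto_sandwich)
  show "\<forall>\<^sub>F n in sequentially. t - (1/2) ^ n \<le> dyadic_floor n t"
  proof (rule always_eventually, rule allI)
    fix n :: nat
    have "0 \<le> 2 ^ n * t" using assms by simp
    then have "2 ^ n * t - 1 \<le> real (nat \<lfloor>2 ^ n * t\<rfloor>)" by linarith
    then have "(2 ^ n * t - 1) / 2 ^ n \<le> dyadic_floor n t"
      unfolding dyadic_floor_def by (rule divide_right_mono) simp
    then show "t - (1/2) ^ n \<le> dyadic_floor n t"
      by (simp add: diff_divide_distrib power_one_over)
  qed
  show "\<forall>\<^sub>F n in sequentially. dyadic_floor n t \<le> t"
    using assms by (intro always_eventually allI dyadic_floor_le)
  have "(\<lambda>n. t - (1/2) ^ n) \<longlonglongrightarrow> t - 0"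
    by (intro tendsto_intros LIMSEQ_realpow_zero) auto
  then show "(\<lambda>n. t - (1/2) ^ n) \<longlonglongrightarrow> t" by simp
qed simp

lemma dyadic_floor_tendsto_path:
  assumes "continuous_on {0..} f" "0 \<le> t"
  shows "(\<lambda>n. f (dyadic_floor n t)) \<longlonglongrightarrow> (f t :: real)"
  using assms by (intro continuous_on_tendsto_compose[OF assms(1)] dyadic_floor_tendsto) auto

text \<open>
  Turns a bound on a whole path segment into countably many conditions on single times. Dyadic
  approximation from below never leaves \<open>[0, u]\<close>.
\<close>

lemma continuous_path_le_iff_dyadic:
  fixes f :: "real \<Rightarrow> real"
  assumes "continuous_on {0..} f"
  shows "(\<forall>x\<in>{0..u}. f x \<le> a) \<longleftrightarrow> (\<forall>n j. real j / 2 ^ n \<le> u \<longrightarrow> f (real j / 2 ^ n) \<le> a)"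
proof safe
  fix x assume *: "\<forall>n j. real j / 2 ^ n \<le> u \<longrightarrow> f (real j / 2 ^ n) \<le> a" and x: "x \<in> {0..u}"
  have "f (dyadic_floor n x) \<le> a" for n
    using * dyadic_floor_le[of x n] x unfolding dyadic_floor_def
    by (meson atLeastAtMost_iff order_trans)
  then show "f x \<le> a"
    using dyadic_floor_tendsto_path[OF assms, of x] x by (intro LIMSEQ_le_const2) auto
qed auto

text \<open>
  Agrees with \<open>X t \<omega>\<close> on continuous paths at times \<open>t \<ge> 0\<close>, but is jointly measurable in \<open>(t, \<omega>)\<close> with
  respect to the \<open>\<sigma>\<close>-algebra of the process even where the paths are discontinuous. This matters because a
  conditional distribution given the process is measurable for that \<open>\<sigma>\<close>-algebra only, and the discontinuous
  paths need not form a measurable set.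
\<close>

definition path_eval :: "(real \<Rightarrow> 'a \<Rightarrow> real) \<Rightarrow> real \<Rightarrow> 'a \<Rightarrow> real" where
  "path_eval X t \<omega> = lim (\<lambda>n. X (dyadic_floor n t) \<omega>)"

lemma path_eval_eq:
  assumes "continuous_on {0..} (\<lambda>t. X t \<omega>)" "0 \<le> t"
  shows "path_eval X t \<omega> = X t \<omega>"
  unfolding path_eval_def by (rule limI) (rule dyadic_floor_tendsto_path[OF assms])

lemma space_process_sigma [simp]: "space (process_sigma M X) = space M"
  by (simp add: process_sigma_def space_measure_of_conv)

lemma sets_process_sigma:
  "sets (process_sigma M X) = 
     sigma_sets (space M) (\<Union>t\<in>{0..}. {X t -` A \<inter> space M | A. A \<in> sets borel})"
  unfolding process_sigma_def by (rule sets_measure_of) auto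

lemma measurable_process_sigma: "0 \<le> t \<Longrightarrow> X t \<in> borel_measurable (process_sigma M X)"
  by (rule measurableI) (auto simp: sets_process_sigma intro!: sigma_sets.Basic)

lemma subalgebra_process_sigma:
  assumes "\<And>t. 0 \<le> t \<Longrightarrow> X t \<in> borel_measurable M"
  shows "subalgebra M (process_sigma M X)"
  unfolding subalgebra_def sets_process_sigma
  using assms by (auto intro!: sets.sigma_sets_subset)

text \<open>
  For each \<open>n\<close> the rounded time takes only countably many values, so each approximant is measurable
  piece by piece.
\<close>

lemma measurable_path_eval:
  assumes "\<And>t. 0 \<le> t \<Longrightarrow> X t \<in> borel_measurable N"
  shows "(\<lambda>p. path_eval X (fst p) (snd p)) \<in> borel_measurable (borel \<Otimes>\<^sub>M N)"
proof -
  have "(\<lambda>p. X (dyadic_floor n (fst p)) (snd p)) \<in> borel_measurable (borel \<Otimes>\<^sub>M N)" for n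
  proof -
    have "(\<lambda>p. X (real (nat \<lfloor>2 ^ n * (fst p :: real)\<rfloor>) / 2 ^ n) (snd p)) \<in> borel_measurable (borel \<Otimes>\<^sub>M N)"
    proof (rule measurable_compose_countable[where f="\<lambda>j p. X (real j / 2 ^ n) (snd p)"
          and g="\<lambda>p. nat \<lfloor>2 ^ n * (fst p :: real)\<rfloor>"])
      fix j :: nat
      have [measurable]: "X (real j / 2 ^ n) \<in> borel_measurable N" by (simp add: assms)
      show "(\<lambda>p. X (real j / 2 ^ n) (snd p)) \<in> borel_measurable (borel \<Otimes>\<^sub>M N)"
        by measurable
    qed measurable
    then show ?thesis unfolding dyadic_floor_def .
  qed
  then show ?thesis unfolding path_eval_def by (rule borel_measurable_lim_metric)
qed

section \<open>Finite-dimensional events and independence of the past\<close>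

text \<open>
  Any finite set of times is a strictly increasing grid starting at \<open>0\<close>; this is the form in which
  independence of increments is available.
\<close>

lemma finite_time_grid:
  fixes H :: "real set"
  assumes "finite H" "H \<subseteq> {0..}"
  shows "\<exists>(n::nat) t. t 0 = 0 \<and> t ` {..n} = insert 0 H \<and> strict_mono_on {..n} t"
proof -
  define xs where "xs = sorted_list_of_set (insert 0 H)"
  have xs: "set xs = insert 0 H" "sorted xs" "distinct xs" "xs \<noteq> []"
  proof -
    have "finite (insert 0 H)" using assms by simp
    then show "set xs = insert 0 H" "sorted xs" "distinct xs" "xs \<noteq> []"
      unfolding xs_def using set_sorted_list_of_set[of "insert 0 H"]
      by (simp_all only: sorted_sorted_list_of_set distinct_sorted_list_of_set) force
  qed
  have ss: "sorted_wrt (<) xs" using xs by (simp add: strict_sorted_iff)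
  have img: "(!) xs ` {..length xs - 1} = insert 0 H"
  proof -
    have "{..length xs - 1} = {..<length xs}" using xs(4) by (cases xs) auto
    then show ?thesis using xs(1) by (simp add: set_conv_nth lessThan_def image_def) blast
  qed
  have x0: "xs ! 0 = 0"
  proof -
    obtain i where i: "i \<le> length xs - 1" "xs ! i = 0" using img by (metis atMost_iff image_iff insertI1)
    have "xs ! 0 \<le> xs ! i" using xs(2,4) i by (intro sorted_nth_mono) (auto simp: Suc_le_eq[symmetric] neq_Nil_conv)
    moreover have "xs ! 0 \<ge> 0" using xs(1,4) assms(2) by (metis insert_subset nth_mem length_greater_0_conv atLeast_iff order_refl subsetD insert_iff)
    ultimately show ?thesis using i by simp
  qed
  have "i < j \<Longrightarrow> j \<le> length xs - 1 \<Longrightarrow> xs ! i < xs ! j" for i j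
    using xs(4) by (intro sorted_wrt_nth_less[OF ss]) (auto simp: neq_Nil_conv)
  then have "strict_mono_on {..length xs - 1} ((!) xs)" by (simp add: strict_mono_on_def)
  with x0 img show ?thesis by blast
qed

definition cylinders :: "'a measure \<Rightarrow> (real \<Rightarrow> 'a \<Rightarrow> real) \<Rightarrow> 'a set set" where
  "cylinders M X = {{\<omega> \<in> space M. \<forall>t\<in>F. X t \<omega> \<in> A t} | F A.
     finite F \<and> F \<subseteq> {0..} \<and> (\<forall>t\<in>F. A t \<in> sets borel)}"

lemma Int_stable_cylinders: "Int_stable (cylinders M X)"
proof (rule Int_stableI)
  fix a b assume "a \<in> cylinders M X" "b \<in> cylinders M X"
  then obtain F A G B where
    F: "finite F" "F \<subseteq> {0..}" "\<forall>t\<in>F. A t \<in> sets borel" "a = {\<omega> \<in> space M. \<forall>t\<in>F. X t \<omega> \<in> A t}" and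
    G: "finite G" "G \<subseteq> {0..}" "\<forall>t\<in>G. B t \<in> sets borel" "b = {\<omega> \<in> space M. \<forall>t\<in>G. X t \<omega> \<in> B t}"
    unfolding cylinders_def by auto
  define C where "C t = (if t \<in> F then A t else UNIV) \<inter> (if t \<in> G then B t else UNIV)" for t
  have "a \<inter> b = {\<omega> \<in> space M. \<forall>t\<in>F \<union> G. X t \<omega> \<in> C t}"
    unfolding F G C_def by auto
  moreover have "\<forall>t\<in>F \<union> G. C t \<in> sets borel" using F G by (auto simp: C_def)
  ultimately show "a \<inter> b \<in> cylinders M X"
    unfolding cylinders_def using F(1,2) G(1,2) by (intro CollectI exI[of _ "F \<union> G"] exI[of _ C]) auto
qed

lemma sigma_sets_cylinders: "sets (process_sigma M X) = sigma_sets (space M) (cylinders M X)"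
proof (rule antisym)
  have "X t -` A \<inter> space M \<in> cylinders M X" if "0 \<le> t" "A \<in> sets borel" for t A
    unfolding cylinders_def using that by (intro CollectI exI[of _ "{t}"] exI[of _ "\<lambda>_. A"]) auto
  then show "sets (process_sigma M X) \<subseteq> sigma_sets (space M) (cylinders M X)"
    unfolding sets_process_sigma by (intro sigma_sets_mono') auto
  have "a \<in> sets (process_sigma M X)" if "a \<in> cylinders M X" for a
  proof -
    from that obtain F A where 
      F: "finite F" "F \<subseteq> {0..}" "\<forall>t\<in>F. A t \<in> sets borel" "a = {\<omega> \<in> space M. \<forall>t\<in>F. X t \<omega> \<in> A t}"
      unfolding cylinders_def by auto
    have "{\<omega> \<in> space (process_sigma M X). \<forall>t\<in>F. X t \<omega> \<in> A t} \<in> sets (process_sigma M X)"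
    proof (rule sets.sets_Collect_finite_All)
      fix t assume t: "t \<in> F"
      then have [measurable]: "X t \<in> borel_measurable (process_sigma M X)" "A t \<in> sets borel"
        using F by (auto intro!: measurable_process_sigma)
      show "{\<omega> \<in> space (process_sigma M X). X t \<omega> \<in> A t} \<in> sets (process_sigma M X)"
        by measurable
    qed (rule F)
    then show ?thesis using F by simp
  qed
  then show "sigma_sets (space M) (cylinders M X) \<subseteq> sets (process_sigma M X)"
    using sets.sigma_sets_subset[of "cylinders M X" "process_sigma M X"] by auto
qed

text \<open>
  For a process started at \<open>0\<close>, the values on a grid are partial sums of the increments, so that
  finite-dimensional events are events of the increment vector. The index map \<open>\<iota>\<close> places these increments
  inside a larger independent family \<open>D\<close>, where they can be separated from the other members of \<open>K\<close>.
\<close>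

lemma cylinder_from_increments:
  fixes X :: "real \<Rightarrow> 'a \<Rightarrow> real" and t :: "nat \<Rightarrow> real" and D :: "'i \<Rightarrow> 'a \<Rightarrow> real"
  assumes "finite F" and A: "\<And>s. s \<in> F \<Longrightarrow> A s \<in> sets borel"
    and g: "\<And>s. s \<in> F \<Longrightarrow> g s \<in> t ` {..n}"
    and X0: "\<And>\<omega>. \<omega> \<in> space M \<Longrightarrow> X (t 0) \<omega> = 0"
    and D: "\<And>i \<omega>. i < n \<Longrightarrow> \<omega> \<in> space M \<Longrightarrow> D (\<iota> i) \<omega> = X (t (Suc i)) \<omega> - X (t i) \<omega>"
    and \<iota>: "\<And>i. i < n \<Longrightarrow> \<iota> i \<in> K"
  obtains S where "S \<in> sets (PiM K (\<lambda>_. borel))"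
    "{\<omega> \<in> space M. \<forall>s\<in>F. X (g s) \<omega> \<in> A s} = (\<lambda>\<omega>. \<lambda>i\<in>K. D i \<omega>) -` S \<inter> space M"
proof -
  from g have "\<forall>s\<in>F. \<exists>k. k \<le> n \<and> g s = t k" by auto
  then obtain k where k: "\<And>s. s \<in> F \<Longrightarrow> k s \<le> n \<and> g s = t (k s)" by metis
  define P where "P = PiM K (\<lambda>_. borel :: real measure)"
  define S where "S = {x \<in> space P. \<forall>s\<in>F. (\<Sum>i<k s. x (\<iota> i)) \<in> A s}"
  have "S \<in> sets P" unfolding S_def
  proof (rule sets.sets_Collect_finite_All)
    fix s assume s: "s \<in> F"
    have "(\<lambda>x. \<Sum>i<k s. x (\<iota> i)) \<in> borel_measurable P"
      unfolding P_def using \<iota> k[OF s] by (intro borel_measurable_sum measurable_component_singleton) auto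
    with A[OF s] show "{x \<in> space P. (\<Sum>i<k s. x (\<iota> i)) \<in> A s} \<in> sets P"
      by measurable
  qed fact
  moreover have "X (g s) \<omega> = (\<Sum>i<k s. (\<lambda>i\<in>K. D i \<omega>) (\<iota> i))" if "s \<in> F" "\<omega> \<in> space M" for s \<omega>
  proof -
    have "(\<Sum>i<k s. (\<lambda>i\<in>K. D i \<omega>) (\<iota> i)) = (\<Sum>i<k s. X (t (Suc i)) \<omega> - X (t i) \<omega>)"
      using k[OF that(1)] \<iota> D that(2) by (intro sum.cong) auto
    also have "\<dots> = X (t (k s)) \<omega> - X (t 0) \<omega>"
      by (rule sum_lessThan_telescope)
    finally show ?thesis using k[OF that(1)] X0[OF that(2)] by simp
  qed
  moreover have "(\<lambda>i\<in>K. D i \<omega>) \<in> space P" for \<omega> by (auto simp: P_def space_PiM)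
  ultimately have "{\<omega> \<in> space M. \<forall>s\<in>F. X (g s) \<omega> \<in> A s} = (\<lambda>\<omega>. \<lambda>i\<in>K. D i \<omega>) -` S \<inter> space M"
    unfolding S_def by auto
  with \<open>S \<in> sets P\<close> show ?thesis using that unfolding P_def by blast
qed

context prob_space
begin

text \<open>
  The past up to time \<open>u\<close> is the \<open>\<sigma>\<close>-algebra of the process stopped at \<open>u\<close>. Its cylinders depend on
  increments over a grid that ends at \<open>u\<close>, and appending the point \<open>u + h\<close> adds one more independent
  increment.
\<close>

lemma increment_indep_past:
  assumes X: "std_brownian_motion M X" and X0: "\<And>\<omega>. \<omega> \<in> space M \<Longrightarrow> X 0 \<omega> = 0"
    and u: "0 \<le> u" and h: "0 < h"
    and a: "a \<in> sets (process_sigma M (\<lambda>s. X (min s u)))" and C: "C \<in> sets borel"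
  shows "prob (a \<inter> {\<omega> \<in> space M. X (u + h) \<omega> - X u \<omega> \<in> C}) 
    = prob a * prob {\<omega> \<in> space M. X (u + h) \<omega> - X u \<omega> \<in> C}"
proof -
  let ?G = "{{\<omega> \<in> space M. X (u + h) \<omega> - X u \<omega> \<in> C} | C. C \<in> sets borel}"
  let ?X = "\<lambda>s. X (min s u)"
  have [measurable]: "X t \<in> borel_measurable M" if "0 \<le> t" for t
    using X that by (auto simp: std_brownian_motion_def)
  have "indep_set (cylinders M ?X) ?G"
    unfolding indep_sets2_eq
  proof (intro conjI ballI)
    have "subalgebra M (process_sigma M ?X)" using u by (intro subalgebra_process_sigma) simp
    then show "cylinders M ?X \<subseteq> events"
      by (auto simp: subalgebra_def sigma_sets_cylinders)
    show "?G \<subseteq> events" using u h by auto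
    fix a b assume "a \<in> cylinders M ?X" "b \<in> ?G"
    then obtain F A C where 
      F: "finite F" "F \<subseteq> {0..}" "\<And>t. t \<in> F \<Longrightarrow> A t \<in> sets borel" and a: "a = {\<omega> \<in> space M. \<forall>t\<in>F. ?X t \<omega> \<in> A t}"
      and C[measurable]: "C \<in> sets borel" and b: "b = {\<omega> \<in> space M. X (u + h) \<omega> - X u \<omega> \<in> C}"
      unfolding cylinders_def by blast
    let ?H = "insert u ((\<lambda>s. min s u) ` F)"
    have H: "finite ?H" "?H \<subseteq> {0..}" using F(1,2) u by (auto simp: subset_iff)
    obtain n :: nat and t where t0: "t 0 = 0" and img: "t ` {..n} = insert 0 ?H" and "strict_mono_on {..n} t"
      using finite_time_grid[OF H] by blast
    then have mono: "\<And>i j. i < j \<Longrightarrow> j \<le> n \<Longrightarrow> t i < t j"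
      by (simp add: strict_mono_on_def)
    have tn: "t n = u"
    proof -
      obtain k where k: "k \<le> n" "t k = u" using img by (metis atMost_iff image_iff insertI1 insertI2)
      moreover have "t n \<le> u" using img u by (smt (verit) atMost_iff image_iff insert_iff order_refl)
      ultimately show ?thesis using mono[of k n] by (cases "k = n") auto
    qed
    define t' where "t' = t(Suc n := u + h)"
    have "0 \<le> t' 0" "\<forall>i<Suc n. t' i \<le> t' (Suc i)"
      using t0 tn h mono by (auto simp: t'_def less_Suc_eq intro: less_imp_le)
    then have ind: "indep_vars (\<lambda>_. borel) (\<lambda>i \<omega>. X (t' (Suc i)) \<omega> - X (t' i) \<omega>) {..<Suc n}"
      using X unfolding std_brownian_motion_def by simp
    let ?D = "\<lambda>i \<omega>. X (t' (Suc i)) \<omega> - X (t' i) \<omega>"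
    have ind2: "indep_var (PiM {..<n} (\<lambda>_. borel)) (\<lambda>\<omega>. \<lambda>i\<in>{..<n}. ?D i \<omega>)
       (PiM {n} (\<lambda>_. borel)) (\<lambda>\<omega>. \<lambda>i\<in>{n}. ?D i \<omega>)"
      by (rule indep_var_restrict[OF ind]) auto
    obtain S where S: "S \<in> sets (PiM {..<n} (\<lambda>_. borel))"
      "{\<omega> \<in> space M. \<forall>s\<in>F. X (min s u) \<omega> \<in> A s} = (\<lambda>\<omega>. \<lambda>i\<in>{..<n}. ?D i \<omega>) -` S \<inter> space M"
    proof (rule cylinder_from_increments[where F=F and A=A and g="\<lambda>s. min s u" and t=t' and n=n and M=M and X=X 
          and D="?D" and \<iota>="\<lambda>i. i" and K="{..<n}"])
      fix s assume "s \<in> F"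
      then have "min s u \<in> t ` {..n}" unfolding img by simp
      then show "min s u \<in> t' ` {..n}" by (auto simp: t'_def)
    qed (use F t0 X0 in \<open>auto simp: t'_def\<close>)
    let ?T = "{x \<in> space (PiM {n} (\<lambda>_. borel)). x n \<in> C}"
    have T: "?T \<in> sets (PiM {n} (\<lambda>_. borel))" by measurable
    define U where "U = (\<lambda>\<omega>. \<lambda>i\<in>{..<n}. ?D i \<omega>)"
    define V where "V = (\<lambda>\<omega>. \<lambda>i\<in>{n}. ?D i \<omega>)"
    have bT: "b = V -` ?T \<inter> space M"
      unfolding b V_def using tn by (auto simp: t'_def space_PiM)
    have aS: "a = U -` S \<inter> space M" unfolding a S(2) U_def ..
    have "a \<inter> b = (\<lambda>\<omega>. (U \<omega>, V \<omega>)) -` (S \<times> ?T) \<inter> space M"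
      unfolding aS bT by auto
    then show "prob (a \<inter> b) = prob a * prob b"
      using indep_varD[OF ind2[folded U_def V_def] S(1) T] unfolding aS bT by simp
  qed
  moreover have "Int_stable ?G"
  proof (rule Int_stableI)
    fix a b assume "a \<in> ?G" "b \<in> ?G"
    then obtain A B where "A \<in> sets borel" "B \<in> sets borel" "a = {\<omega> \<in> space M. X (u + h) \<omega> - X u \<omega> \<in> A}"
      "b = {\<omega> \<in> space M. X (u + h) \<omega> - X u \<omega> \<in> B}" by blast
    then show "a \<inter> b \<in> ?G" by (intro CollectI exI[of _ "A \<inter> B"]) auto
  qed
  ultimately have "indep_set (sigma_sets (space M) (cylinders M ?X)) (sigma_sets (space M) ?G)"
    by (intro indep_set_sigma_sets Int_stable_cylinders)
  from indep_setD[OF this] a C show ?thesis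
    by (auto simp: sigma_sets_cylinders intro: sigma_sets.Basic)
qed

lemma indep_var_of_indep_set:
  assumes "indep_set (sets F) (sets G)" "space F = space M" "space G = space M"
    and X: "X \<in> measurable F S" and Y: "Y \<in> measurable G T"
  shows "indep_var S X T Y"
proof -
  have sub: "subalgebra M F" "subalgebra M G"
    using indep_setD_ev1[OF assms(1)] indep_setD_ev2[OF assms(1)] assms(2,3)
    by (auto simp: subalgebra_def)
  have "sigma_sets (space M) {X -` A \<inter> space M |A. A \<in> sets S} \<subseteq> sets F"
    using measurable_sets[OF X] assms(2) by (intro sets.sigma_sets_subset[of _ F, unfolded assms(2)]) auto
  moreover have "sigma_sets (space M) {Y -` A \<inter> space M |A. A \<in> sets T} \<subseteq> sets G"
    using measurable_sets[OF Y] assms(3) by (intro sets.sigma_sets_subset[of _ G, unfolded assms(3)]) auto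
  ultimately show ?thesis
    unfolding indep_var_eq using assms(1) measurable_from_subalg[OF sub(1) X] measurable_from_subalg[OF sub(2) Y]
    unfolding indep_sets2_eq by blast
qed

lemma indep_vars_pairs:
  fixes U V :: "nat \<Rightarrow> 'a \<Rightarrow> real"
  assumes [measurable]: "\<And>i. i < n \<Longrightarrow> U i \<in> borel_measurable M" "\<And>i. i < n \<Longrightarrow> V i \<in> borel_measurable M"
    and prod: "\<And>A C. (\<And>i. i < n \<Longrightarrow> A i \<in> sets borel) \<Longrightarrow> (\<And>i. i < n \<Longrightarrow> C i \<in> sets borel) \<Longrightarrow>
      prob {\<omega> \<in> space M. \<forall>i<n. U i \<omega> \<in> A i \<and> V i \<omega> \<in> C i} =
      (\<Prod>i<n. prob {\<omega> \<in> space M. U i \<omega> \<in> A i} * prob {\<omega> \<in> space M. V i \<omega> \<in> C i})"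
  shows "indep_vars (\<lambda>_. borel) (\<lambda>(b, i). if b then U i else V i) (UNIV \<times> {..<n})"
proof (cases "n = 0")
  case True then show ?thesis by (simp add: indep_vars_def indep_sets_def)
next
  case False
  let ?X = "\<lambda>(b, i). if b then U i else V i"
  let ?I = "(UNIV :: bool set) \<times> {..<n}"
  have "prob (\<Inter>j\<in>?I. ?X j -` A j \<inter> space M) = (\<Prod>j\<in>?I. prob (?X j -` A j \<inter> space M))"
    if A: "A \<in> (\<Pi> i\<in>?I. sets borel)" for A
  proof -
    have A': "A (b, i) \<in> sets borel" if "i < n" for b i using A that by auto
    have "(\<Inter>j\<in>?I. ?X j -` A j \<inter> space M) = 
      {\<omega> \<in> space M. \<forall>i<n. U i \<omega> \<in> A (True, i) \<and> V i \<omega> \<in> A (False, i)}" (is "?l = ?r")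
    proof (intro set_eqI)
      fix \<omega>
      have "0 < n" using False by simp
      have "\<omega> \<in> ?l \<longleftrightarrow> (\<forall>i\<in>{..<n}. \<omega> \<in> U i -` A (True, i) \<inter> space M) \<and> (\<forall>i\<in>{..<n}. \<omega> \<in> V i -` A (False, i) \<inter> space M)"
        by (simp only: INT_iff split_paired_Ball_Sigma ball_UNIV all_bool_eq prod.case if_True if_False)
      also have "\<dots> \<longleftrightarrow> \<omega> \<in> ?r" using \<open>0 < n\<close> by auto
      finally show "\<omega> \<in> ?l \<longleftrightarrow> \<omega> \<in> ?r" .
    qed
    then have "prob (\<Inter>j\<in>?I. ?X j -` A j \<inter> space M) = 
       (\<Prod>i<n. prob {\<omega> \<in> space M. U i \<omega> \<in> A (True, i)} * prob {\<omega> \<in> space M. V i \<omega> \<in> A (False, i)})"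
      using prod[of "\<lambda>i. A (True, i)" "\<lambda>i. A (False, i)"] A' by simp
    also have "\<dots> = (\<Prod>b\<in>UNIV. \<Prod>i<n. prob (?X (b, i) -` A (b, i) \<inter> space M))"
      by (simp add: UNIV_bool prod.distrib vimage_def Int_def conj_commute mult.commute)
    also have "\<dots> = (\<Prod>j\<in>?I. prob (?X j -` A j \<inter> space M))"
      by (simp add: prod.cartesian_product split_beta)
    finally show ?thesis .
  qed
  then show ?thesis
    using False by (subst indep_vars_finite[where E="\<lambda>_. sets borel"])
      (auto simp: Int_stable_def sets.sigma_sets_eq[of borel, simplified])
qed

end

section \<open>Rotating a pair of Gaussian variables\<close>

text \<open>
  The density of two independent centred normal variables of equal variance depends only on the radius.
\<close>

lemma normal_density_mult_rotate:
  assumes "a\<^sup>2 + b\<^sup>2 = c\<^sup>2 + d\<^sup>2"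
  shows "normal_density 0 s a * normal_density 0 s b = normal_density 0 s c * normal_density 0 s d"
proof -
  have "normal_density 0 s a * normal_density 0 s b = (1 / sqrt (2 * pi * s\<^sup>2))\<^sup>2 * exp (- (a\<^sup>2 + b\<^sup>2) / (2 * s\<^sup>2))" for a b
    by (simp add: normal_density_def power2_eq_square add_divide_distrib mult_exp_exp diff_divide_distrib)
  then show ?thesis using assms by simp
qed

text \<open>
  Invariance of the planar Gaussian measure under an orthogonal map (of determinant \<open>-1\<close>, loosely called a
  rotation here). The map is a composition of two shears with scaling, each changing a single
  coordinate, so that one-dimensional affine substitution and Fubini suffice: \<open>x = \<sigma> y + \<kappa> z\<close> for fixed \<open>y\<close>, then \<open>y = (w - \<sigma> z) / \<kappa>\<close> for fixed \<open>z\<close>.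
\<close>

lemma nn_integral_normal_rotate:
  fixes f :: "real \<times> real \<Rightarrow> ennreal" and \<sigma> s :: real
  assumes f[measurable]: "f \<in> borel_measurable (borel \<Otimes>\<^sub>M borel)" and s: "0 < s"
  defines "\<kappa> \<equiv> sqrt (1 + \<sigma>\<^sup>2)" and "\<phi> \<equiv> \<lambda>x. ennreal (normal_density 0 s x)"
  shows "(\<integral>\<^sup>+y. \<integral>\<^sup>+x. f ((\<sigma> * x + y) / \<kappa>, (x - \<sigma> * y) / \<kappa>) * (\<phi> x * \<phi> y) \<partial>lborel \<partial>lborel)
    = (\<integral>\<^sup>+z. \<integral>\<^sup>+w. f (w, z) * (\<phi> w * \<phi> z) \<partial>lborel \<partial>lborel)"
proof -
  have \<kappa>: "\<kappa> > 0" "\<kappa>\<^sup>2 = 1 + \<sigma>\<^sup>2" by (auto simp: \<kappa>_def add_pos_nonneg)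
  have [measurable]: "\<phi> \<in> borel_measurable borel" by (simp add: \<phi>_def)
  have mult: "\<phi> a * \<phi> b = \<phi> c * \<phi> d" if "a\<^sup>2 + b\<^sup>2 = c\<^sup>2 + d\<^sup>2" for a b c d
    unfolding \<phi>_def by (simp add: ennreal_mult[symmetric] normal_density_mult_rotate[OF that])
  have "(\<integral>\<^sup>+y. \<integral>\<^sup>+x. f ((\<sigma> * x + y) / \<kappa>, (x - \<sigma> * y) / \<kappa>) * (\<phi> x * \<phi> y) \<partial>lborel \<partial>lborel)
    = (\<integral>\<^sup>+y. \<integral>\<^sup>+z. ennreal \<kappa> * (f (\<kappa> * y + \<sigma> * z, z) * (\<phi> (\<sigma> * y + \<kappa> * z) * \<phi> y)) \<partial>lborel \<partial>lborel)"
  proof (rule nn_integral_cong)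
    fix y :: real
    have 1: "(\<sigma> * (\<sigma> * y + \<kappa> * z) + y) / \<kappa> = \<kappa> * y + \<sigma> * z" "(\<sigma> * y + \<kappa> * z - \<sigma> * y) / \<kappa> = z" for z
    proof -
      have "\<sigma> * (\<sigma> * y + \<kappa> * z) + y = \<kappa>\<^sup>2 * y + \<kappa> * (\<sigma> * z)" unfolding \<kappa>(2) by (simp add: algebra_simps power2_eq_square)
      then show "(\<sigma> * (\<sigma> * y + \<kappa> * z) + y) / \<kappa> = \<kappa> * y + \<sigma> * z" using \<kappa>(1) by (simp add: field_simps power2_eq_square)
    qed (use \<kappa> in simp)
    show "(\<integral>\<^sup>+x. f ((\<sigma> * x + y) / \<kappa>, (x - \<sigma> * y) / \<kappa>) * (\<phi> x * \<phi> y) \<partial>lborel)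
      = (\<integral>\<^sup>+z. ennreal \<kappa> * (f (\<kappa> * y + \<sigma> * z, z) * (\<phi> (\<sigma> * y + \<kappa> * z) * \<phi> y)) \<partial>lborel)"
      using \<kappa>(1) by (subst nn_integral_real_affine[where c=\<kappa> and t="\<sigma> * y"]) (auto simp: 1 nn_integral_cmult)
  qed
  also have "\<dots> = (\<integral>\<^sup>+z. \<integral>\<^sup>+y. ennreal \<kappa> * (f (\<kappa> * y + \<sigma> * z, z) * (\<phi> (\<sigma> * y + \<kappa> * z) * \<phi> y)) \<partial>lborel \<partial>lborel)"
    by (rule lborel_pair.Fubini') measurable
  also have "\<dots> = (\<integral>\<^sup>+z. \<integral>\<^sup>+w. f (w, z) * (\<phi> w * \<phi> z) \<partial>lborel \<partial>lborel)"
  proof (rule nn_integral_cong)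
    fix z :: real
    have 1: "\<kappa> * (w / \<kappa> - \<sigma> * z / \<kappa>) + \<sigma> * z = w" for w using \<kappa> by (simp add: field_simps)
    have 2: "\<phi> (\<sigma> * (w / \<kappa> - \<sigma> * z / \<kappa>) + \<kappa> * z) * \<phi> (w / \<kappa> - \<sigma> * z / \<kappa>) = \<phi> w * \<phi> z" for w
    proof (rule mult)
      have "\<sigma> * (w / \<kappa> - \<sigma> * z / \<kappa>) + \<kappa> * z = (\<sigma> * w + (\<kappa>\<^sup>2 - \<sigma>\<^sup>2) * z) / \<kappa>"
        using \<kappa>(1) by (simp add: field_simps power2_eq_square)
      then have e: "\<sigma> * (w / \<kappa> - \<sigma> * z / \<kappa>) + \<kappa> * z = (\<sigma> * w + z) / \<kappa>" using \<kappa>(2) by simp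
      have e2: "w / \<kappa> - \<sigma> * z / \<kappa> = (w - \<sigma> * z) / \<kappa>" by (simp add: diff_divide_distrib)
      have "(p / \<kappa>)\<^sup>2 + (q / \<kappa>)\<^sup>2 = (p\<^sup>2 + q\<^sup>2) / \<kappa>\<^sup>2" for p q
        by (simp add: power_divide add_divide_distrib)
      then have "((\<sigma> * w + z) / \<kappa>)\<^sup>2 + ((w - \<sigma> * z) / \<kappa>)\<^sup>2 = ((\<sigma> * w + z)\<^sup>2 + (w - \<sigma> * z)\<^sup>2) / \<kappa>\<^sup>2"
        by blast
      also have "(\<sigma> * w + z)\<^sup>2 + (w - \<sigma> * z)\<^sup>2 = \<kappa>\<^sup>2 * (w\<^sup>2 + z\<^sup>2)"
        unfolding \<kappa>(2) by (simp add: power2_eq_square algebra_simps)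
      finally show "(\<sigma> * (w / \<kappa> - \<sigma> * z / \<kappa>) + \<kappa> * z)\<^sup>2 + (w / \<kappa> - \<sigma> * z / \<kappa>)\<^sup>2 = w\<^sup>2 + z\<^sup>2"
        unfolding e unfolding e2 using \<kappa>(1) by simp
    qed
    have "(\<integral>\<^sup>+w. f (w, z) * (\<phi> w * \<phi> z) \<partial>lborel) = 
      (\<integral>\<^sup>+w. f (\<kappa> * (w / \<kappa> - \<sigma> * z / \<kappa>) + \<sigma> * z, z) * 
        (\<phi> (\<sigma> * (w / \<kappa> - \<sigma> * z / \<kappa>) + \<kappa> * z) * \<phi> (w / \<kappa> - \<sigma> * z / \<kappa>)) \<partial>lborel)"
      by (simp only: 1 2)
    also have "\<dots> = (\<integral>\<^sup>+y. ennreal \<kappa> * (f (\<kappa> * y + \<sigma> * z, z) * (\<phi> (\<sigma> * y + \<kappa> * z) * \<phi> y)) \<partial>lborel)"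
      using \<kappa>(1) by (subst nn_integral_real_affine[where c=\<kappa> and t="\<sigma> * z"]) 
        (auto simp: add_divide_distrib nn_integral_cmult)
    finally show "(\<integral>\<^sup>+y. ennreal \<kappa> * (f (\<kappa> * y + \<sigma> * z, z) * (\<phi> (\<sigma> * y + \<kappa> * z) * \<phi> y)) \<partial>lborel)
       = (\<integral>\<^sup>+w. f (w, z) * (\<phi> w * \<phi> z) \<partial>lborel)" ..
  qed
  finally show ?thesis .
qed

lemma distr_normal_rotate:
  fixes \<sigma> s :: real
  assumes s: "0 < s"
  defines "\<kappa> \<equiv> sqrt (1 + \<sigma>\<^sup>2)" and "N \<equiv> density lborel (\<lambda>x. ennreal (normal_density 0 s x))"
  shows "distr (N \<Otimes>\<^sub>M N) (borel \<Otimes>\<^sub>M borel) (\<lambda>(x, y). ((\<sigma> * x + y) / \<kappa>, (x - \<sigma> * y) / \<kappa>)) = N \<Otimes>\<^sub>M N"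
    (is "distr _ _ ?R = _")
proof -
  let ?\<phi> = "\<lambda>x. ennreal (normal_density 0 s x)"
  have sets_N[measurable_cong]: "sets N = sets borel" by (simp add: N_def)
  interpret N: prob_space N unfolding N_def by (rule prob_space_normal_density[OF s])
  have NN: "N \<Otimes>\<^sub>M N = density (lborel \<Otimes>\<^sub>M lborel) (\<lambda>(x, y). ?\<phi> x * ?\<phi> y)"
    unfolding N_def
    by (rule pair_measure_density) (auto intro: prob_space_imp_sigma_finite prob_space_normal_density s lborel.sigma_finite_measure_axioms)
  have int: "(\<integral>\<^sup>+p. f p \<partial>(N \<Otimes>\<^sub>M N)) = (\<integral>\<^sup>+y. \<integral>\<^sup>+x. f (x, y) * (?\<phi> x * ?\<phi> y) \<partial>lborel \<partial>lborel)"
    if [measurable]: "f \<in> borel_measurable (borel \<Otimes>\<^sub>M borel)" for f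
  proof -
    have "(\<integral>\<^sup>+p. f p \<partial>(N \<Otimes>\<^sub>M N)) = (\<integral>\<^sup>+p. (case p of (x, y) \<Rightarrow> ?\<phi> x * ?\<phi> y) * f p \<partial>(lborel \<Otimes>\<^sub>M lborel))"
      unfolding NN by (rule nn_integral_density) auto
    also have "\<dots> = (\<integral>\<^sup>+y. \<integral>\<^sup>+x. (?\<phi> x * ?\<phi> y) * f (x, y) \<partial>lborel \<partial>lborel)"
      by (subst lborel_pair.nn_integral_snd[symmetric]) auto
    finally show ?thesis by (simp add: mult.commute)
  qed
  show ?thesis
  proof (rule measure_eqI)
    fix A assume "A \<in> sets (distr (N \<Otimes>\<^sub>M N) (borel \<Otimes>\<^sub>M borel) ?R)"
    then have A[measurable]: "A \<in> sets (borel \<Otimes>\<^sub>M borel)" by simp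
    have R[measurable]: "?R \<in> borel \<Otimes>\<^sub>M borel \<rightarrow>\<^sub>M borel \<Otimes>\<^sub>M borel" by measurable
    have R': "?R \<in> N \<Otimes>\<^sub>M N \<rightarrow>\<^sub>M borel \<Otimes>\<^sub>M borel" by measurable
    have "emeasure (distr (N \<Otimes>\<^sub>M N) (borel \<Otimes>\<^sub>M borel) ?R) A 
        = (\<integral>\<^sup>+p. indicator A p \<partial>distr (N \<Otimes>\<^sub>M N) (borel \<Otimes>\<^sub>M borel) ?R)"
      by simp
    also have "\<dots> = (\<integral>\<^sup>+p. indicator A (?R p) \<partial>(N \<Otimes>\<^sub>M N))"
      by (rule nn_integral_distr[OF R']) simp
    also have "\<dots> = (\<integral>\<^sup>+y. \<integral>\<^sup>+x. indicator A (?R (x, y)) * (?\<phi> x * ?\<phi> y) \<partial>lborel \<partial>lborel)"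
      by (rule int) measurable
    also have "\<dots> = (\<integral>\<^sup>+z. \<integral>\<^sup>+w. indicator A (w, z) * (?\<phi> w * ?\<phi> z) \<partial>lborel \<partial>lborel)"
      unfolding prod.case \<kappa>_def by (rule nn_integral_normal_rotate[OF _ s]) simp
    also have "\<dots> = (\<integral>\<^sup>+p. indicator A p \<partial>(N \<Otimes>\<^sub>M N))"
      by (rule int[symmetric]) measurable
    also have "\<dots> = emeasure (N \<Otimes>\<^sub>M N) A" 
      by (rule nn_integral_indicator) measurable
    finally show "emeasure (distr (N \<Otimes>\<^sub>M N) (borel \<Otimes>\<^sub>M borel) ?R) A = emeasure (N \<Otimes>\<^sub>M N) A" .
  next
    show "sets (distr (N \<Otimes>\<^sub>M N) (borel \<Otimes>\<^sub>M borel) ?R) = sets (N \<Otimes>\<^sub>M N)"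
      unfolding sets_distr by (rule sets_pair_measure_cong) (simp_all add: N_def)
  qed
qed

context prob_space
begin

lemma normal_rotate:
  fixes \<sigma> s :: real
  assumes ind: "indep_var borel X borel Y" and s: "0 < s"
    and X: "distributed M lborel X (normal_density 0 s)" and Y: "distributed M lborel Y (normal_density 0 s)"
  defines "\<kappa> \<equiv> sqrt (1 + \<sigma>\<^sup>2)"
  defines "P \<equiv> \<lambda>\<omega>. (\<sigma> * X \<omega> + Y \<omega>) / \<kappa>" and "Q \<equiv> \<lambda>\<omega>. (X \<omega> - \<sigma> * Y \<omega>) / \<kappa>"
  shows "indep_var borel P borel Q"
    and "distributed M lborel P (normal_density 0 s)" "distributed M lborel Q (normal_density 0 s)"
proof -
  define N where "N = density lborel (\<lambda>x. ennreal (normal_density 0 s x))"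
  have sets_N[measurable_cong]: "sets N = sets borel" by (simp add: N_def)
  interpret N: prob_space N unfolding N_def by (rule prob_space_normal_density[OF s])
  have [measurable]: "X \<in> borel_measurable M" "Y \<in> borel_measurable M"
    using X Y by (auto simp: distributed_def)
  have [measurable]: "P \<in> borel_measurable M" "Q \<in> borel_measurable M" by (auto simp: P_def Q_def)
  have "distr M borel X = distr M lborel X" "distr M borel Y = distr M lborel Y"
    by (auto intro!: distr_cong)
  then have dX: "distr M borel X = N" "distr M borel Y = N"
    using X Y by (auto simp: distributed_def N_def)
  have XY: "distr M (borel \<Otimes>\<^sub>M borel) (\<lambda>\<omega>. (X \<omega>, Y \<omega>)) = N \<Otimes>\<^sub>M N"
    using ind dX unfolding indep_var_distribution_eq by simp
  let ?R = "\<lambda>(x, y). ((\<sigma> * x + y) / \<kappa>, (x - \<sigma> * y) / \<kappa>)"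
  have "distr M (borel \<Otimes>\<^sub>M borel) (\<lambda>\<omega>. (P \<omega>, Q \<omega>)) 
     = distr (distr M (borel \<Otimes>\<^sub>M borel) (\<lambda>\<omega>. (X \<omega>, Y \<omega>))) (borel \<Otimes>\<^sub>M borel) ?R"
    by (subst distr_distr) (auto simp: P_def Q_def comp_def)
  also have "\<dots> = N \<Otimes>\<^sub>M N"
    unfolding XY unfolding N_def \<kappa>_def by (rule distr_normal_rotate[OF s])
  finally have PQ: "distr M (borel \<Otimes>\<^sub>M borel) (\<lambda>\<omega>. (P \<omega>, Q \<omega>)) = N \<Otimes>\<^sub>M N" .
  interpret NN: pair_prob_space N N ..
  have dP: "distr M borel P = N"
  proof (rule measure_eqI)
    fix A assume "A \<in> sets (distr M borel P)"
    then have [measurable]: "A \<in> sets borel" by simp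
    have "emeasure (distr M borel P) A = emeasure (distr M (borel \<Otimes>\<^sub>M borel) (\<lambda>\<omega>. (P \<omega>, Q \<omega>))) (A \<times> UNIV)"
      by (subst (1 2) emeasure_distr) (auto intro!: arg_cong[where f="emeasure M"])
    also have "\<dots> = emeasure N A * emeasure N (space N)" unfolding PQ
      by (subst N.emeasure_pair_measure_Times) (auto simp: sets_N N_def)
    finally show "emeasure (distr M borel P) A = emeasure N A" by (simp add: N.emeasure_space_1)
  qed (simp add: N_def)
  have dQ: "distr M borel Q = N"
  proof (rule measure_eqI)
    fix A assume "A \<in> sets (distr M borel Q)"
    then have [measurable]: "A \<in> sets borel" by simp
    have "emeasure (distr M borel Q) A = emeasure (distr M (borel \<Otimes>\<^sub>M borel) (\<lambda>\<omega>. (P \<omega>, Q \<omega>))) (UNIV \<times> A)"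
      by (subst (1 2) emeasure_distr) (auto intro!: arg_cong[where f="emeasure M"])
    also have "\<dots> = emeasure N (space N) * emeasure N A" unfolding PQ
      by (subst N.emeasure_pair_measure_Times) (auto simp: sets_N N_def)
    finally show "emeasure (distr M borel Q) A = emeasure N A" by (simp add: N.emeasure_space_1)
  qed (simp add: N_def)
  show "indep_var borel P borel Q"
    unfolding indep_var_distribution_eq using dP dQ PQ by simp
  have "distr M lborel P = distr M borel P" "distr M lborel Q = distr M borel Q"
    by (auto intro!: distr_cong)
  then show "distributed M lborel P (normal_density 0 s)" "distributed M lborel Q (normal_density 0 s)"
    unfolding distributed_def dP dQ N_def by auto
qed

end

section \<open>Rotating a pair of Brownian motions\<close>

text \<open>
  Initial values are subtracted so that the rotated processes start at \<open>0\<close> everywhere, not just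
  almost surely; then they are determined by their increments.
\<close>

definition rotated_sum :: "real \<Rightarrow> (real \<Rightarrow> 'a \<Rightarrow> real) \<Rightarrow> (real \<Rightarrow> 'a \<Rightarrow> real) \<Rightarrow> real \<Rightarrow> 'a \<Rightarrow> real" where
  "rotated_sum \<sigma> B W t \<omega> = (\<sigma> * (B t \<omega> - B 0 \<omega>) + (W t \<omega> - W 0 \<omega>)) / sqrt (1 + \<sigma>\<^sup>2)"

definition rotated_diff :: "real \<Rightarrow> (real \<Rightarrow> 'a \<Rightarrow> real) \<Rightarrow> (real \<Rightarrow> 'a \<Rightarrow> real) \<Rightarrow> real \<Rightarrow> 'a \<Rightarrow> real" where
  "rotated_diff \<sigma> B W t \<omega> = ((B t \<omega> - B 0 \<omega>) - \<sigma> * (W t \<omega> - W 0 \<omega>)) / sqrt (1 + \<sigma>\<^sup>2)"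

context prob_space
begin

lemma indep_increment_pairs:
  assumes B: "std_brownian_motion M B" and W: "std_brownian_motion M W" and BW: "indep_processes M B W"
    and t: "0 \<le> t 0" "\<forall>i<n. t i \<le> t (Suc i)"
  shows "indep_vars (\<lambda>_. borel) 
    (\<lambda>(b, i). if b then (\<lambda>\<omega>. B (t (Suc i)) \<omega> - B (t i) \<omega>) else (\<lambda>\<omega>. W (t (Suc i)) \<omega> - W (t i) \<omega>)) (UNIV \<times> {..<n})"
proof -
  have t_ge: "0 \<le> t i" if "i \<le> n" for i
    using that by (induction i) (use t in \<open>auto intro: order_trans\<close>)
  let ?FB = "process_sigma M B" and ?FW = "process_sigma M W"
  let ?U = "\<lambda>i \<omega>. B (t (Suc i)) \<omega> - B (t i) \<omega>" and ?V = "\<lambda>i \<omega>. W (t (Suc i)) \<omega> - W (t i) \<omega>"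
  have U: "?U i \<in> borel_measurable ?FB" and V: "?V i \<in> borel_measurable ?FW" if "i < n" for i
    using t_ge that by (auto intro!: borel_measurable_diff measurable_process_sigma)
  have indU: "indep_vars (\<lambda>_. borel) ?U {..<n}" and indV: "indep_vars (\<lambda>_. borel) ?V {..<n}"
    using B W t unfolding std_brownian_motion_def by simp_all
  have prods: "prob {\<omega> \<in> space M. \<forall>i<n. X i \<omega> \<in> A i} = (\<Prod>i<n. prob {\<omega> \<in> space M. X i \<omega> \<in> A i})"
    if "indep_vars (\<lambda>_. borel) X {..<n}" "\<And>i. i < n \<Longrightarrow> A i \<in> sets borel" for X :: "nat \<Rightarrow> 'a \<Rightarrow> real" and A
  proof (cases "n = 0")
    case False
    have "{\<omega> \<in> space M. \<forall>i<n. X i \<omega> \<in> A i} = (\<Inter>i\<in>{..<n}. X i -` A i \<inter> space M)"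
      using False by auto
    moreover have "X i -` A i \<inter> space M = {\<omega> \<in> space M. X i \<omega> \<in> A i}" for i by auto
    moreover have "{..<n} \<noteq> {}" using False by auto
    ultimately show ?thesis
      using indep_varsD_finite[OF that(1), of A] that(2) by simp
  qed (simp add: prob_space)
  show ?thesis
  proof (rule indep_vars_pairs)
    show "?U i \<in> borel_measurable M" "?V i \<in> borel_measurable M" if "i < n" for i
      using indU indV that by (auto simp: indep_vars_def)
    fix A C :: "nat \<Rightarrow> real set"
    assume A: "\<And>i. i < n \<Longrightarrow> A i \<in> sets borel" and C: "\<And>i. i < n \<Longrightarrow> C i \<in> sets borel"
    let ?a = "{\<omega> \<in> space M. \<forall>i<n. ?U i \<omega> \<in> A i}" and ?b = "{\<omega> \<in> space M. \<forall>i<n. ?V i \<omega> \<in> C i}"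
    have fin: "{\<omega> \<in> space M. \<forall>i<n. X i \<omega> \<in> A i} \<in> sets F"
      if "\<And>i. i < n \<Longrightarrow> X i \<in> borel_measurable F" "\<And>i. i < n \<Longrightarrow> A i \<in> sets borel" "space F = space M"
      for F :: "'a measure" and X :: "nat \<Rightarrow> 'a \<Rightarrow> real" and A
    proof -
      have "{\<omega> \<in> space F. \<forall>i\<in>{..<n}. X i \<omega> \<in> A i} \<in> sets F"
      proof (rule sets.sets_Collect_finite_All)
        fix i assume "i \<in> {..<n}"
        then have [measurable]: "X i \<in> borel_measurable F" "A i \<in> sets borel" using that by auto
        show "{\<omega> \<in> space F. X i \<omega> \<in> A i} \<in> sets F" by measurable
      qed simp
      then show ?thesis unfolding that(3) Ball_def lessThan_iff .
    qed
    have ab: "prob (?a \<inter> ?b) = prob ?a * prob ?b"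
      by (rule indep_setD[OF BW[unfolded indep_processes_def]]; rule fin; (rule U V A C; assumption)?)
        (simp_all only: space_process_sigma)
    have "{\<omega> \<in> space M. \<forall>i<n. ?U i \<omega> \<in> A i \<and> ?V i \<omega> \<in> C i} = ?a \<inter> ?b" by blast
    then show "prob {\<omega> \<in> space M. \<forall>i<n. ?U i \<omega> \<in> A i \<and> ?V i \<omega> \<in> C i} =
      (\<Prod>i<n. prob {\<omega> \<in> space M. ?U i \<omega> \<in> A i} * prob {\<omega> \<in> space M. ?V i \<omega> \<in> C i})"
      by (simp only: ab prods[OF indU A] prods[OF indV C] prod.distrib)
  qed
qed

lemma rotated_increments:
  fixes \<sigma> :: real
  assumes B: "std_brownian_motion M B" and W: "std_brownian_motion M W" and BW: "indep_processes M B W"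
    and st: "0 \<le> s" "s < t"
  defines "P \<equiv> \<lambda>\<omega>. rotated_sum \<sigma> B W t \<omega> - rotated_sum \<sigma> B W s \<omega>"
    and "Q \<equiv> \<lambda>\<omega>. rotated_diff \<sigma> B W t \<omega> - rotated_diff \<sigma> B W s \<omega>"
  shows "indep_var borel P borel Q"
    "distributed M lborel P (normal_density 0 (sqrt (t - s)))"
    "distributed M lborel Q (normal_density 0 (sqrt (t - s)))"
proof -
  let ?X = "\<lambda>\<omega>. B t \<omega> - B s \<omega>" and ?Y = "\<lambda>\<omega>. W t \<omega> - W s \<omega>"
  have "?X \<in> borel_measurable (process_sigma M B)" "?Y \<in> borel_measurable (process_sigma M W)"
    using st by (auto intro!: borel_measurable_diff measurable_process_sigma)
  then have ind: "indep_var borel ?X borel ?Y"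
    using BW unfolding indep_processes_def by (intro indep_var_of_indep_set) auto
  have d: "distributed M lborel ?X (normal_density 0 (sqrt (t - s)))" "distributed M lborel ?Y (normal_density 0 (sqrt (t - s)))"
    using B W st by (simp_all add: std_brownian_motion_def)
  have P: "P = (\<lambda>\<omega>. (\<sigma> * ?X \<omega> + ?Y \<omega>) / sqrt (1 + \<sigma>\<^sup>2))"
    by (simp add: P_def rotated_sum_def diff_divide_distrib[symmetric] algebra_simps)
  have Q: "Q = (\<lambda>\<omega>. (?X \<omega> - \<sigma> * ?Y \<omega>) / sqrt (1 + \<sigma>\<^sup>2))"
    by (simp add: Q_def rotated_diff_def diff_divide_distrib[symmetric] algebra_simps)
  show "indep_var borel P borel Q" 
    "distributed M lborel P (normal_density 0 (sqrt (t - s)))"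
    "distributed M lborel Q (normal_density 0 (sqrt (t - s)))"
    unfolding P Q using normal_rotate[OF ind _ d] st by simp_all
qed

text \<open>
  Rotation acts on the increments over each grid interval separately. Pairs over different
  intervals are independent because they are functions of disjoint parts of an independent family;
  within an interval independence is the rotation invariance of the Gaussian pair.
\<close>

lemma indep_rotated_increment_pairs:
  fixes \<sigma> :: real
  assumes B: "std_brownian_motion M B" and W: "std_brownian_motion M W" and BW: "indep_processes M B W"
    and t: "0 \<le> t 0" "\<forall>i<n. t i \<le> t (Suc i)"
  defines "P \<equiv> \<lambda>i \<omega>. rotated_sum \<sigma> B W (t (Suc i)) \<omega> - rotated_sum \<sigma> B W (t i) \<omega>"
    and "Q \<equiv> \<lambda>i \<omega>. rotated_diff \<sigma> B W (t (Suc i)) \<omega> - rotated_diff \<sigma> B W (t i) \<omega>"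
  shows "indep_vars (\<lambda>_. borel \<Otimes>\<^sub>M borel) (\<lambda>i \<omega>. (P i \<omega>, Q i \<omega>)) {..<n}" (is ?pairs)
    and "indep_vars (\<lambda>_. borel) (\<lambda>(b, i). if b then P i else Q i) (UNIV \<times> {..<n})"
proof -
  have t_ge: "0 \<le> t i" if "i \<le> n" for i
    using that by (induction i) (use t in \<open>auto intro: order_trans\<close>)
  let ?Z = "\<lambda>(b, i). if b then (\<lambda>\<omega>. B (t (Suc i)) \<omega> - B (t i) \<omega>) else (\<lambda>\<omega>. W (t (Suc i)) \<omega> - W (t i) \<omega>)"
  let ?K = "\<lambda>i. UNIV \<times> {i} :: (bool \<times> nat) set"
  have "indep_vars (\<lambda>j. PiM (?K j) (\<lambda>_. borel)) (\<lambda>j \<omega>. restrict (\<lambda>i. ?Z i \<omega>) (?K j)) {..<n}"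
    by (rule indep_vars_restrict[OF indep_increment_pairs[OF B W BW t]]) (auto simp: disjoint_family_on_def)
  then have "indep_vars (\<lambda>_. borel \<Otimes>\<^sub>M borel) (\<lambda>j \<omega>. (\<lambda>x. ((\<sigma> * x (True, j) + x (False, j)) / sqrt (1 + \<sigma>\<^sup>2),
      (x (True, j) - \<sigma> * x (False, j)) / sqrt (1 + \<sigma>\<^sup>2))) (restrict (\<lambda>i. ?Z i \<omega>) (?K j))) {..<n}"
    by (rule indep_vars_compose2) measurable
  moreover have "(\<lambda>x. ((\<sigma> * x (True, j) + x (False, j)) / sqrt (1 + \<sigma>\<^sup>2),
      (x (True, j) - \<sigma> * x (False, j)) / sqrt (1 + \<sigma>\<^sup>2))) (restrict (\<lambda>i. ?Z i \<omega>) (?K j)) = (P j \<omega>, Q j \<omega>)" for j \<omega>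
    by (simp add: P_def Q_def rotated_sum_def rotated_diff_def diff_divide_distrib[symmetric] algebra_simps)
  ultimately show pairs: ?pairs by simp
  \<comment> \<open>The case distinction accounts for grid intervals of length zero, on which both increments vanish.\<close>
  have PQ: "indep_var borel (P i) borel (Q i)" if i: "i < n" for i
  proof (cases "t i = t (Suc i)")
    case True
    then have "P i \<in> borel_measurable (process_sigma M B)" "Q i \<in> borel_measurable (process_sigma M W)"
      by (simp_all add: P_def Q_def)
    then show ?thesis
      using BW unfolding indep_processes_def by (intro indep_var_of_indep_set) auto
  next
    case False
    then show ?thesis unfolding P_def Q_def
      using t i t_ge[of i] by (intro rotated_increments(1)[OF B W BW]) auto
  qed
  show "indep_vars (\<lambda>_. borel) (\<lambda>(b, i). if b then P i else Q i) (UNIV \<times> {..<n})"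
  proof (rule indep_vars_pairs)
    show "P i \<in> borel_measurable M" "Q i \<in> borel_measurable M" if "i < n" for i
      using indep_var_rv1[OF PQ[OF that]] indep_var_rv2[OF PQ[OF that]] by auto
    fix A C :: "nat \<Rightarrow> real set"
    assume A: "\<And>i. i < n \<Longrightarrow> A i \<in> sets borel" and C: "\<And>i. i < n \<Longrightarrow> C i \<in> sets borel"
    show "prob {\<omega> \<in> space M. \<forall>i<n. P i \<omega> \<in> A i \<and> Q i \<omega> \<in> C i} =
      (\<Prod>i<n. prob {\<omega> \<in> space M. P i \<omega> \<in> A i} * prob {\<omega> \<in> space M. Q i \<omega> \<in> C i})"
    proof (cases "n = 0")
      case False
      have "{\<omega> \<in> space M. \<forall>i<n. P i \<omega> \<in> A i \<and> Q i \<omega> \<in> C i} = 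
         (\<Inter>i\<in>{..<n}. (\<lambda>\<omega>. (P i \<omega>, Q i \<omega>)) -` (A i \<times> C i) \<inter> space M)"
        using False by auto
      also have "prob \<dots> = (\<Prod>i<n. prob ((\<lambda>\<omega>. (P i \<omega>, Q i \<omega>)) -` (A i \<times> C i) \<inter> space M))"
        using False A C by (intro indep_varsD_finite[OF pairs]) auto
      also have "\<dots> = (\<Prod>i<n. prob (P i -` A i \<inter> space M) * prob (Q i -` C i \<inter> space M))"
        using A C by (intro prod.cong refl indep_varD[OF PQ]) auto
      finally show ?thesis by (simp add: vimage_def Int_def conj_commute)
    qed (simp add: prob_space)
  qed
qed

lemma std_brownian_motion_rotated:
  assumes B: "std_brownian_motion M B" and W: "std_brownian_motion M W" and BW: "indep_processes M B W"
  shows "std_brownian_motion M (rotated_sum \<sigma> B W)" "std_brownian_motion M (rotated_diff \<sigma> B W)"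
proof -
  have [measurable]: "B t \<in> borel_measurable M" "W t \<in> borel_measurable M" if "0 \<le> t" for t
    using B W that by (auto simp: std_brownian_motion_def)
  have BWcont: "AE \<omega> in M. continuous_on {0..} (\<lambda>t. B t \<omega>)" "AE \<omega> in M. continuous_on {0..} (\<lambda>t. W t \<omega>)"
    using B W by (auto simp: std_brownian_motion_def)
  have "1 + \<sigma>\<^sup>2 \<noteq> 0" by (smt (verit) zero_le_power2)
  then have rot: "continuous_on {0..} (\<lambda>t. rotated_sum \<sigma> B W t \<omega>) \<and> continuous_on {0..} (\<lambda>t. rotated_diff \<sigma> B W t \<omega>)"
    if "continuous_on {0..} (\<lambda>t. B t \<omega>)" "continuous_on {0..} (\<lambda>t. W t \<omega>)" for \<omega>
    unfolding rotated_sum_def rotated_diff_def using that by (auto intro!: continuous_intros)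
  have "AE \<omega> in M. continuous_on {0..} (\<lambda>t. rotated_sum \<sigma> B W t \<omega>) \<and> continuous_on {0..} (\<lambda>t. rotated_diff \<sigma> B W t \<omega>)"
    using BWcont by eventually_elim (rule rot)
  then have cont: "AE \<omega> in M. continuous_on {0..} (\<lambda>t. rotated_sum \<sigma> B W t \<omega>)" 
    "AE \<omega> in M. continuous_on {0..} (\<lambda>t. rotated_diff \<sigma> B W t \<omega>)"
    by simp_all
  have meas: "rotated_sum \<sigma> B W t \<in> borel_measurable M" "rotated_diff \<sigma> B W t \<in> borel_measurable M" if "0 \<le> t" for t
    using that by (simp_all add: rotated_sum_def[abs_def] rotated_diff_def[abs_def])
  have inc: "indep_vars (\<lambda>_. borel) (\<lambda>i \<omega>. rotated_sum \<sigma> B W (t (Suc i)) \<omega> - rotated_sum \<sigma> B W (t i) \<omega>) {..<n}"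
    "indep_vars (\<lambda>_. borel) (\<lambda>i \<omega>. rotated_diff \<sigma> B W (t (Suc i)) \<omega> - rotated_diff \<sigma> B W (t i) \<omega>) {..<n}"
    if "0 \<le> t 0" "\<forall>i<n. t i \<le> t (Suc i)" for n t
    using indep_vars_compose2[OF indep_rotated_increment_pairs(1)[OF B W BW that], of "\<lambda>_. fst" "\<lambda>_. borel"]
      indep_vars_compose2[OF indep_rotated_increment_pairs(1)[OF B W BW that], of "\<lambda>_. snd" "\<lambda>_. borel"] by simp_all
  have zero: "rotated_sum \<sigma> B W 0 \<omega> = 0" "rotated_diff \<sigma> B W 0 \<omega> = 0" for \<omega>
    by (simp_all add: rotated_sum_def rotated_diff_def)
  have zero': "AE \<omega> in M. rotated_sum \<sigma> B W 0 \<omega> = 0" "AE \<omega> in M. rotated_diff \<sigma> B W 0 \<omega> = 0"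
    by (simp_all add: zero)
  note inc' = rotated_increments(2)[OF B W BW] rotated_increments(3)[OF B W BW]
  show "std_brownian_motion M (rotated_sum \<sigma> B W)" 
    unfolding std_brownian_motion_def
    using cont(1) meas(1) inc(1) inc'(1) zero'(1) by blast
  show "std_brownian_motion M (rotated_diff \<sigma> B W)"
    unfolding std_brownian_motion_def
    using cont(2) meas(2) inc(2) inc'(2) zero'(2) by blast
qed

lemma indep_processes_rotated:
  assumes B: "std_brownian_motion M B" and W: "std_brownian_motion M W" and BW: "indep_processes M B W"
  shows "indep_processes M (rotated_sum \<sigma> B W) (rotated_diff \<sigma> B W)"
proof -
  let ?P = "rotated_sum \<sigma> B W" and ?Q = "rotated_diff \<sigma> B W"
  have meas: "?P t \<in> borel_measurable M" "?Q t \<in> borel_measurable M" if "0 \<le> t" for t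
    using std_brownian_motion_rotated[OF B W BW] that by (auto simp: std_brownian_motion_def)
  have "indep_set (cylinders M ?P) (cylinders M ?Q)"
    unfolding indep_sets2_eq
  proof (intro conjI ballI)
    show "cylinders M ?P \<subseteq> events" "cylinders M ?Q \<subseteq> events"
      using subalgebra_process_sigma[of ?P M] subalgebra_process_sigma[of ?Q M] meas
      by (auto simp: subalgebra_def sigma_sets_cylinders)
    fix a b assume ab: "a \<in> cylinders M ?P" "b \<in> cylinders M ?Q"
    obtain F A where F: "finite F" "F \<subseteq> {0..}" "\<And>t. t \<in> F \<Longrightarrow> A t \<in> sets borel"
      and a: "a = {\<omega> \<in> space M. \<forall>t\<in>F. ?P t \<omega> \<in> A t}"
      using ab(1) unfolding cylinders_def by blast
    obtain G C where G: "finite G" "G \<subseteq> {0..}" "\<And>t. t \<in> G \<Longrightarrow> C t \<in> sets borel"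
      and b: "b = {\<omega> \<in> space M. \<forall>t\<in>G. ?Q t \<omega> \<in> C t}"
      using ab(2) unfolding cylinders_def by blast
    have H: "finite (F \<union> G)" "F \<union> G \<subseteq> {0..}" using F G by auto
    obtain n :: nat and t where t0: "t 0 = 0" and img: "t ` {..n} = insert 0 (F \<union> G)" and "strict_mono_on {..n} t"
      using finite_time_grid[OF H] by blast
    then have "0 \<le> t 0" "\<forall>i<n. t i \<le> t (Suc i)"
      by (auto simp: strict_mono_on_def intro: less_imp_le)
    note ind = indep_rotated_increment_pairs(2)[OF B W BW this, of \<sigma>]
    let ?D = "\<lambda>(b, i). if b then (\<lambda>\<omega>. ?P (t (Suc i)) \<omega> - ?P (t i) \<omega>) else (\<lambda>\<omega>. ?Q (t (Suc i)) \<omega> - ?Q (t i) \<omega>)"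
    define U where "U = (\<lambda>\<omega>. \<lambda>i\<in>{True} \<times> {..<n}. ?D i \<omega>)"
    define V where "V = (\<lambda>\<omega>. \<lambda>i\<in>{False} \<times> {..<n}. ?D i \<omega>)"
    have UV: "indep_var (PiM ({True} \<times> {..<n}) (\<lambda>_. borel)) U (PiM ({False} \<times> {..<n}) (\<lambda>_. borel)) V"
      unfolding U_def V_def by (rule indep_var_restrict[OF ind]) auto
    have FG: "s \<in> t ` {..n}" if "s \<in> F" for s using img that by simp
    have FG': "s \<in> t ` {..n}" if "s \<in> G" for s using img that by simp
    have P0: "?P (t 0) \<omega> = 0" "?Q (t 0) \<omega> = 0" for \<omega>
      by (simp_all add: t0 rotated_sum_def rotated_diff_def)
    obtain S where S: "S \<in> sets (PiM ({True} \<times> {..<n}) (\<lambda>_. borel))" "{\<omega> \<in> space M. \<forall>s\<in>F. ?P s \<omega> \<in> A s} = U -` S \<inter> space M"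
      unfolding U_def
      by (rule cylinder_from_increments[where F=F and A=A and g="\<lambda>s. s" and t=t and n=n and M=M and X="?P" 
          and D="?D" and \<iota>="\<lambda>i. (True, i)" and K="{True} \<times> {..<n}"])
        (use F(1,3) FG P0(1) in \<open>simp_all\<close>)
    obtain T where T: "T \<in> sets (PiM ({False} \<times> {..<n}) (\<lambda>_. borel))" "{\<omega> \<in> space M. \<forall>s\<in>G. ?Q s \<omega> \<in> C s} = V -` T \<inter> space M"
      unfolding V_def
      by (rule cylinder_from_increments[where F=G and A=C and g="\<lambda>s. s" and t=t and n=n and M=M and X="?Q" 
          and D="?D" and \<iota>="\<lambda>i. (False, i)" and K="{False} \<times> {..<n}"])
        (use G(1,3) FG' P0(2) in \<open>simp_all\<close>)
    have aS: "a = U -` S \<inter> space M" and bT: "b = V -` T \<inter> space M"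
      unfolding a b by (rule S(2), rule T(2))
    then have "a \<inter> b = (\<lambda>\<omega>. (U \<omega>, V \<omega>)) -` (S \<times> T) \<inter> space M"
      by auto
    then show "prob (a \<inter> b) = prob a * prob b"
      using indep_varD[OF UV S(1) T(1)] unfolding aS bT by simp
  qed
  then show ?thesis
    unfolding indep_processes_def sigma_sets_cylinders
    by (intro indep_set_sigma_sets Int_stable_cylinders)
qed

end

section \<open>Averages of a Brownian path over many scales\<close>

text \<open>
  Compares the path at \<open>t\<close> with its values at the earlier times \<open>t - s k\<close>, in units of the Brownian
  fluctuation \<open>sqrt (s k)\<close>.
\<close>

definition scale_average :: "(real \<Rightarrow> real) \<Rightarrow> nat \<Rightarrow> (nat \<Rightarrow> real) \<Rightarrow> real \<Rightarrow> real" where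
  "scale_average x N s t = (\<Sum>k<N. (x (t - s k) - x t) / sqrt (s k)) / real N"

context prob_space
begin

lemma brownian_increment_moments:
  assumes X: "std_brownian_motion M X" and ab: "0 \<le> a" "a \<le> b"
  shows "integrable M (\<lambda>\<omega>. X b \<omega> - X a \<omega>)" "expectation (\<lambda>\<omega>. X b \<omega> - X a \<omega>) = 0"
    "integrable M (\<lambda>\<omega>. (X b \<omega> - X a \<omega>)\<^sup>2)" "expectation (\<lambda>\<omega>. (X b \<omega> - X a \<omega>)\<^sup>2) = b - a"
proof -
  have "integrable M (\<lambda>\<omega>. X b \<omega> - X a \<omega>) \<and> expectation (\<lambda>\<omega>. X b \<omega> - X a \<omega>) = 0 \<and>
    integrable M (\<lambda>\<omega>. (X b \<omega> - X a \<omega>)\<^sup>2) \<and> expectation (\<lambda>\<omega>. (X b \<omega> - X a \<omega>)\<^sup>2) = b - a"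
  proof (cases "a = b")
    case False
    let ?D = "\<lambda>\<omega>. X b \<omega> - X a \<omega>" and ?s = "sqrt (b - a)"
    have s: "0 < ?s" using False ab by simp
    have D: "distributed M lborel ?D (normal_density 0 ?s)"
      using X False ab by (simp add: std_brownian_motion_def)
    have e: "expectation ?D = 0" using normal_distributed_expectation[OF s D] .
    have "integrable M (\<lambda>\<omega>. ?D \<omega> ^ k)" for k
      using integrable_normal_moment[OF s, of 0 k] distributed_integrable[OF D, of "\<lambda>x. x ^ k"] by simp
    from this[of 1] this[of 2] show ?thesis
      using normal_distributed_variance[OF s D] e s by simp
  qed simp
  then show "integrable M (\<lambda>\<omega>. X b \<omega> - X a \<omega>)" "expectation (\<lambda>\<omega>. X b \<omega> - X a \<omega>) = 0"
    "integrable M (\<lambda>\<omega>. (X b \<omega> - X a \<omega>)\<^sup>2)" "expectation (\<lambda>\<omega>. (X b \<omega> - X a \<omega>)\<^sup>2) = b - a" by blast+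
qed

text \<open>
  On the shorter backward interval both factors share the same increment, which alone produces the
  covariance.
\<close>

lemma brownian_backward_covariance:
  assumes X: "std_brownian_motion M X" and st: "0 \<le> q" "q \<le> p" "p \<le> t"
  shows "integrable M (\<lambda>\<omega>. (X (t - p) \<omega> - X t \<omega>) * (X (t - q) \<omega> - X t \<omega>))"
    "expectation (\<lambda>\<omega>. (X (t - p) \<omega> - X t \<omega>) * (X (t - q) \<omega> - X t \<omega>)) = q"
proof -
  define g where "g i = (if i = 0 then t - p else if i = 1 then t - q else t)" for i :: nat
  let ?D = "\<lambda>i \<omega>. X (g (Suc i)) \<omega> - X (g i) \<omega>"
  have "0 \<le> g 0" "\<forall>i<2. g i \<le> g (Suc i)" using st by (auto simp: g_def less_2_cases_iff)
  then have ind: "indep_vars (\<lambda>_. borel) ?D {..<2}"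
    using X unfolding std_brownian_motion_def by blast
  have i0: "integrable M (?D i)" "expectation (?D i) = 0" if "i \<in> {..<2}" for i
    using that brownian_increment_moments(1,2)[OF X, of "g i" "g (Suc i)"] st
    by (auto simp: g_def less_2_cases_iff)
  have 2: "{..<2::nat} = {0, 1}" by auto
  have "expectation (\<lambda>\<omega>. \<Prod>i\<in>{..<2}. ?D i \<omega>) = (\<Prod>i\<in>{..<2}. expectation (?D i))"
    "integrable M (\<lambda>\<omega>. \<Prod>i\<in>{..<2}. ?D i \<omega>)"
    using indep_vars_lebesgue_integral[OF _ ind] indep_vars_integrable[OF _ ind] i0 by auto
  then have D: "expectation (\<lambda>\<omega>. ?D 0 \<omega> * ?D 1 \<omega>) = 0" "integrable M (\<lambda>\<omega>. ?D 0 \<omega> * ?D 1 \<omega>)"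
    using i0(2)[of 0] by (auto simp: 2)
  have sq: "integrable M (\<lambda>\<omega>. (?D 1 \<omega>)\<^sup>2)" "expectation (\<lambda>\<omega>. (?D 1 \<omega>)\<^sup>2) = q"
    using brownian_increment_moments(3,4)[OF X, of "t - q" t] st by (auto simp: g_def)
  have eq: "(\<lambda>\<omega>. (X (t - p) \<omega> - X t \<omega>) * (X (t - q) \<omega> - X t \<omega>)) = (\<lambda>\<omega>. ?D 0 \<omega> * ?D 1 \<omega> + (?D 1 \<omega>)\<^sup>2)"
    by (auto simp: g_def fun_eq_iff power2_eq_square algebra_simps)
  show "integrable M (\<lambda>\<omega>. (X (t - p) \<omega> - X t \<omega>) * (X (t - q) \<omega> - X t \<omega>))"
    "expectation (\<lambda>\<omega>. (X (t - p) \<omega> - X t \<omega>) * (X (t - q) \<omega> - X t \<omega>)) = q"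
    unfolding eq using D sq by simp_all
qed

text \<open>
  The normalised backward increments on scales \<open>p \<ge> q\<close> have covariance \<open>sqrt (q / p)\<close>, which decays
  geometrically in the distance of the scale indices. The second moment of the sum is therefore linear in
  \<open>N\<close>: each new term adds its variance \<open>1\<close> and twice a covariance sum that is at most \<open>2\<close>.
\<close>

lemma scale_sum_second_moment:
  assumes X: "std_brownian_motion M X" and r: "0 < r"
    and s: "\<And>k. k < N \<Longrightarrow> r / 4 ^ k \<le> s k \<and> s k \<le> 2 * r / 4 ^ k" and t: "2 * r \<le> t"
  shows "integrable M (\<lambda>\<omega>. (\<Sum>k<N. (X (t - s k) \<omega> - X t \<omega>) / sqrt (s k))\<^sup>2)"
    "expectation (\<lambda>\<omega>. (\<Sum>k<N. (X (t - s k) \<omega> - X t \<omega>) / sqrt (s k))\<^sup>2) \<le> 5 * real N"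
proof -
  let ?U = "\<lambda>k \<omega>. (X (t - s k) \<omega> - X t \<omega>) / sqrt (s k)"
  have s_pos: "0 < s k" if "k < N" for k
    using s[OF that] r by (smt (verit) divide_pos_pos zero_less_power)
  have s_le: "s k \<le> t" if "k < N" for k
  proof -
    have "2 * r / 4 ^ k \<le> 2 * r / 1" using r by (intro divide_left_mono) auto
    then show ?thesis using s[OF that] t by simp
  qed
  have cov: "integrable M (\<lambda>\<omega>. ?U l \<omega> * ?U k \<omega>)" "expectation (\<lambda>\<omega>. ?U l \<omega> * ?U k \<omega>) = sqrt (s k / s l)"
    if "s k \<le> s l" "l < N" "k < N" for l k
  proof -
    have eq: "(\<lambda>\<omega>. ?U l \<omega> * ?U k \<omega>) = 
      (\<lambda>\<omega>. (X (t - s l) \<omega> - X t \<omega>) * (X (t - s k) \<omega> - X t \<omega>) / (sqrt (s l) * sqrt (s k)))"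
      by simp
    note c = brownian_backward_covariance[OF X less_imp_le[OF s_pos[OF that(3)]] that(1) s_le[OF that(2)]]
    show "integrable M (\<lambda>\<omega>. ?U l \<omega> * ?U k \<omega>)" unfolding eq using c(1) by simp
    have "expectation (\<lambda>\<omega>. ?U l \<omega> * ?U k \<omega>) = s k / (sqrt (s l) * sqrt (s k))"
      unfolding eq using c(2) by simp
    also have "\<dots> = (s k / sqrt (s k)) / sqrt (s l)" by (simp add: mult.commute)
    also have "\<dots> = sqrt (s k / s l)"
      using s_pos[OF that(3)] by (simp only: real_div_sqrt real_sqrt_divide less_imp_le)
    finally show "expectation (\<lambda>\<omega>. ?U l \<omega> * ?U k \<omega>) = sqrt (s k / s l)" .
  qed
  have "integrable M (\<lambda>\<omega>. (\<Sum>k<n. ?U k \<omega>)\<^sup>2) \<and> expectation (\<lambda>\<omega>. (\<Sum>k<n. ?U k \<omega>)\<^sup>2) \<le> 5 * real n"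
    if "n \<le> N" for n
    using that
  proof (induction n)
    case 0 then show ?case by simp
  next
    case (Suc n)
    have mono: "s n \<le> s l" and dec: "sqrt (s n / s l) \<le> 2 * (1/2) ^ (n - l)" if "l < n" for l
    proof -
      define d where "d = n - l"
      have d: "n = l + d" "0 < d" using that by (simp_all add: d_def)
      have "(4::real) ^ 1 \<le> 4 ^ d" using d by (intro power_increasing) auto
      then have "2 * r / 4 ^ n \<le> r / 4 ^ l" using r d by (simp add: power_add field_simps)
      then show "s n \<le> s l" using s[of n] s[of l] that Suc by auto
      have "s n / s l \<le> (2 * r / 4 ^ n) / (r / 4 ^ l)"
        using s[of n] s[of l] that Suc r by (intro frac_le) auto
      also have "\<dots> = 2 * (1 / 4) ^ d" using r d by (simp add: power_add power_one_over)
      also have "\<dots> \<le> (2 * (1/2) ^ d)\<^sup>2" 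
        by (simp add: power_mult_distrib power_even_eq[symmetric] power_one_over power2_eq_square power_mult_distrib[symmetric] divide_right_mono)
      finally have "sqrt (s n / s l) \<le> 2 * (1/2) ^ d" by (intro real_le_lsqrt) auto
      then show "sqrt (s n / s l) \<le> 2 * (1/2) ^ (n - l)" using d by simp
    qed
    have geo: "(\<Sum>l<n. (1/2::real) ^ (n - l)) \<le> 1"
    proof -
      have "(\<Sum>l<n. (1/2::real) ^ (n - l)) = (\<Sum>l<n. (1/2) ^ Suc l)"
        by (rule sum.reindex_bij_witness[where i="\<lambda>l. n - Suc l" and j="\<lambda>l. n - Suc l"])
          (auto simp: Suc_diff_Suc simp del: power_Suc)
      also have "\<dots> = 1 - (1/2) ^ n" by (induction n) auto
      finally show ?thesis by simp
    qed
    have eq: "(\<lambda>\<omega>. (\<Sum>k<Suc n. ?U k \<omega>)\<^sup>2) = 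
      (\<lambda>\<omega>. (\<Sum>k<n. ?U k \<omega>)\<^sup>2 + 2 * (\<Sum>l<n. ?U l \<omega> * ?U n \<omega>) + ?U n \<omega> * ?U n \<omega>)"
      unfolding sum_distrib_right[symmetric] by (simp add: fun_eq_iff power2_eq_square algebra_simps)
    have nN: "n < N" using Suc by simp
    have IH: "integrable M (\<lambda>\<omega>. (\<Sum>k<n. ?U k \<omega>)\<^sup>2)" "expectation (\<lambda>\<omega>. (\<Sum>k<n. ?U k \<omega>)\<^sup>2) \<le> 5 * real n"
      using Suc by auto
    have cr: "integrable M (\<lambda>\<omega>. \<Sum>l<n. ?U l \<omega> * ?U n \<omega>)"
      using mono nN by (intro Bochner_Integration.integrable_sum cov(1)) auto
    have "expectation (\<lambda>\<omega>. \<Sum>l<n. ?U l \<omega> * ?U n \<omega>) = (\<Sum>l<n. expectation (\<lambda>\<omega>. ?U l \<omega> * ?U n \<omega>))"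
      using mono nN by (intro Bochner_Integration.integral_sum cov(1)) auto
    also have "\<dots> = (\<Sum>l<n. sqrt (s n / s l))"
      using mono nN by (intro sum.cong cov(2)) auto
    also have "\<dots> \<le> (\<Sum>l<n. 2 * (1/2) ^ (n - l))"
      using dec by (intro sum_mono) auto
    also have "\<dots> \<le> 2" using geo by (simp add: sum_distrib_left[symmetric])
    finally have "expectation (\<lambda>\<omega>. \<Sum>l<n. ?U l \<omega> * ?U n \<omega>) \<le> 2" .
    moreover have "integrable M (\<lambda>\<omega>. ?U n \<omega> * ?U n \<omega>)" "expectation (\<lambda>\<omega>. ?U n \<omega> * ?U n \<omega>) = 1"
      using cov[OF order_refl nN nN] s_pos[OF nN] by simp_all
    ultimately show ?case unfolding eq using IH cr by simp
  qed
  from this[of N] show "integrable M (\<lambda>\<omega>. (\<Sum>k<N. (X (t - s k) \<omega> - X t \<omega>) / sqrt (s k))\<^sup>2)"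
    "expectation (\<lambda>\<omega>. (\<Sum>k<N. (X (t - s k) \<omega> - X t \<omega>) / sqrt (s k))\<^sup>2) \<le> 5 * real N" by auto
qed

lemma measurable_scale_average:
  assumes "\<And>t. 0 \<le> t \<Longrightarrow> X t \<in> borel_measurable F"
  shows "(\<lambda>p. scale_average (\<lambda>u. path_eval X u (snd p)) N s (fst p)) \<in> borel_measurable (borel \<Otimes>\<^sub>M F)"
proof -
  note path = measurable_path_eval[OF assms]
  have "(\<lambda>p. path_eval X (fst p - u) (snd p)) \<in> borel_measurable (borel \<Otimes>\<^sub>M F)" for u
    using measurable_compose[OF _ path, of "\<lambda>p. (fst p - u, snd p)" "borel \<Otimes>\<^sub>M F"] by simp
  then show ?thesis
    unfolding scale_average_def using path
    by (intro borel_measurable_divide borel_measurable_sum borel_measurable_diff) auto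
qed

lemma scale_average_tail:
  assumes X: "std_brownian_motion M X" and r: "0 < r" and N: "0 < N" and \<eta>: "0 < \<eta>"
    and s: "\<And>k. k < N \<Longrightarrow> r / 4 ^ k \<le> s k \<and> s k \<le> 2 * r / 4 ^ k" and t: "2 * r \<le> t"
  shows "prob {\<omega> \<in> space M. \<eta> \<le> \<bar>scale_average (\<lambda>u. path_eval X u \<omega>) N s t\<bar>} \<le> 5 / (real N * \<eta>\<^sup>2)"
proof -
  let ?V = "\<lambda>\<omega>. \<Sum>k<N. (X (t - s k) \<omega> - X t \<omega>) / sqrt (s k)"
  have s_le: "s k \<le> t" if "k < N" for k
  proof -
    have "2 * r / 4 ^ k \<le> 2 * r / 1" using r by (intro divide_left_mono) auto
    then show ?thesis using s[OF that] t by simp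
  qed
  have [measurable]: "X t \<in> borel_measurable M" if "0 \<le> t" for t
    using X that by (auto simp: std_brownian_motion_def)
  have V: "?V \<in> borel_measurable M"
    using s_le r t by (intro borel_measurable_sum borel_measurable_divide borel_measurable_diff) auto
  have cont: "AE \<omega> in M. continuous_on {0..} (\<lambda>t. X t \<omega>)" using X by (simp add: std_brownian_motion_def)
  have avg: "scale_average (\<lambda>u. path_eval X u \<omega>) N s t = ?V \<omega> / real N"
    if "continuous_on {0..} (\<lambda>t. X t \<omega>)" for \<omega>
    unfolding scale_average_def using s_le r t
    by (intro arg_cong2[where f="(/)"] sum.cong refl arg_cong2[where f="(-)"] path_eval_eq[where X=X, OF that]) auto
  have mS: "(\<lambda>\<omega>. scale_average (\<lambda>u. path_eval X u \<omega>) N s t) \<in> borel_measurable M"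
    using measurable_compose[OF _ measurable_scale_average[where X=X and F=M and N=N and s=s], of "\<lambda>\<omega>. (t, \<omega>)" M] by simp
  have "prob {\<omega> \<in> space M. \<eta> \<le> \<bar>scale_average (\<lambda>u. path_eval X u \<omega>) N s t\<bar>} =
     prob {\<omega> \<in> space M. \<eta>\<^sup>2 * (real N)\<^sup>2 \<le> (?V \<omega>)\<^sup>2}"
  proof (rule finite_measure_eq_AE)
    have "\<eta> \<le> \<bar>v / real N\<bar> \<longleftrightarrow> \<eta>\<^sup>2 * (real N)\<^sup>2 \<le> v\<^sup>2" for v
    proof -
      have "\<eta> \<le> \<bar>v / real N\<bar> \<longleftrightarrow> \<eta> * real N \<le> \<bar>v\<bar>" using N by (simp add: pos_le_divide_eq)
      also have "\<dots> \<longleftrightarrow> \<bar>\<eta> * real N\<bar> \<le> \<bar>v\<bar>" using \<eta> by simp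
      finally show ?thesis by (simp only: abs_le_square_iff power_mult_distrib)
    qed
    with cont avg show "AE \<omega> in M. (\<omega> \<in> {\<omega> \<in> space M. \<eta> \<le> \<bar>scale_average (\<lambda>u. path_eval X u \<omega>) N s t\<bar>}) =
        (\<omega> \<in> {\<omega> \<in> space M. \<eta>\<^sup>2 * (real N)\<^sup>2 \<le> (?V \<omega>)\<^sup>2})"
      by (elim AE_mp) (auto intro!: AE_I2)
  qed (use mS V in measurable)
  also have "\<dots> \<le> expectation (\<lambda>\<omega>. (?V \<omega>)\<^sup>2) / (\<eta>\<^sup>2 * (real N)\<^sup>2)"
    using scale_sum_second_moment(1)[OF X r s t] \<eta> N by (intro integral_Markov_inequality_measure[where A="{}"]) (auto simp del: power_divide)
  also have "\<dots> \<le> 5 * real N / (\<eta>\<^sup>2 * (real N)\<^sup>2)"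
    using scale_sum_second_moment(2)[OF X r s t] \<eta> N by (intro divide_right_mono) auto
  also have "\<dots> = 5 / (real N * \<eta>\<^sup>2)" using N by (simp add: power2_eq_square field_simps)
  finally show ?thesis .
qed

end

section \<open>First passage of a level\<close>

definition first_passage :: "(real \<Rightarrow> real) \<Rightarrow> real \<Rightarrow> real \<Rightarrow> bool" where
  "first_passage z b T \<longleftrightarrow> 0 \<le> T \<and> z T = b \<and> (\<forall>u\<in>{0..<T}. z u < b)"

definition stays_below :: "(real \<Rightarrow> real) \<Rightarrow> real \<Rightarrow> real \<Rightarrow> bool" where
  "stays_below z b u \<longleftrightarrow> (\<exists>m::nat. \<forall>n j. real j / 2 ^ n \<le> u \<longrightarrow> z (real j / 2 ^ n) \<le> b - 1 / real (Suc m))"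

text \<open>
  A continuous path that has not reached \<open>b\<close> by time \<open>u\<close> stays away from \<open>b\<close> by a positive margin on the
  compact interval \<open>[0, u]\<close>. The condition \<open>stays_below\<close> involves the path only at countably many times up to \<open>u\<close>,
  so it makes \<open>{u < \<tau>}\<close> an event of the past.
\<close>

lemma stays_below_iff:
  assumes cont: "continuous_on {0..} z" and T: "first_passage z b T" and u: "0 \<le> u"
  shows "stays_below z b u \<longleftrightarrow> u < T"
proof -
  have "stays_below z b u \<longleftrightarrow> (\<exists>m::nat. \<forall>x\<in>{0..u}. z x \<le> b - 1 / real (Suc m))"
    unfolding stays_below_def continuous_path_le_iff_dyadic[OF cont] ..
  also have "\<dots> \<longleftrightarrow> u < T"
  proof
    assume "\<exists>m::nat. \<forall>x\<in>{0..u}. z x \<le> b - 1 / real (Suc m)"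
    then obtain m :: nat where m: "\<forall>x\<in>{0..u}. z x \<le> b - 1 / real (Suc m)" ..
    have "z x < b" if "x \<in> {0..u}" for x
    proof -
      have "0 < 1 / real (Suc m)" by simp
      moreover have "z x \<le> b - 1 / real (Suc m)" using m that by blast
      ultimately show ?thesis by linarith
    qed
    then have "T \<notin> {0..u}" using T unfolding first_passage_def by blast
    then show "u < T" using T unfolding first_passage_def by simp
  next
    assume uT: "u < T"
    have "continuous_on {0..u} z" using cont by (rule continuous_on_subset) auto
    then obtain x where x: "x \<in> {0..u}" "\<forall>y\<in>{0..u}. z y \<le> z x"
      using continuous_attains_sup[of "{0..u}" z] u by auto
    have "z x < b" using x(1) uT T by (auto simp: first_passage_def)
    then obtain m :: nat where "1 / real (Suc m) < b - z x"
      using nat_approx_posE[of "b - z x"] by auto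
    then show "\<exists>m::nat. \<forall>x\<in>{0..u}. z x \<le> b - 1 / real (Suc m)"
    proof (intro exI[of _ m] ballI)
      fix y assume "y \<in> {0..u}"
      then have "z y \<le> z x" using x(2) by blast
      with \<open>1 / real (Suc m) < b - z x\<close> show "z y \<le> b - 1 / real (Suc m)" by linarith
    qed
  qed
  finally show ?thesis .
qed

lemma pred_stays_below:
  assumes Z: "\<And>t. 0 \<le> t \<Longrightarrow> t \<le> u \<Longrightarrow> Z t \<in> borel_measurable F"
  shows "Measurable.pred F (\<lambda>\<omega>. stays_below (\<lambda>t. Z t \<omega>) b u)"
proof -
  have "Measurable.pred F (\<lambda>\<omega>. real j / 2 ^ n \<le> u \<longrightarrow> Z (real j / 2 ^ n) \<omega> \<le> b - 1 / real (Suc m))" for n j m :: nat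
  proof (cases "real j / 2 ^ n \<le> u")
    case True
    have [measurable]: "Z (real j / 2 ^ n) \<in> borel_measurable F" by (rule Z) (use True in auto)
    show ?thesis by measurable
  qed simp
  then show ?thesis unfolding stays_below_def
    by (intro pred_intros_countable)
qed

context prob_space
begin

text \<open>
  On \<open>{u < \<tau>}\<close> with \<open>Z u\<close> within \<open>a\<close> of the level, an increment larger than \<open>a\<close> over the following time
  \<open>a\<^sup>2\<close> carries the path across the level. By scaling, the probability \<open>p0\<close> of such an increment does not depend on
  \<open>a\<close>, and the increment is independent of the past.
\<close>

lemma hitting_prob_near_level:
  assumes Z: "std_brownian_motion M Z" and Z0: "\<And>\<omega>. \<omega> \<in> space M \<Longrightarrow> Z 0 \<omega> = 0"
    and \<tau>[measurable]: "\<tau> \<in> borel_measurable M" and fp: "AE \<omega> in M. first_passage (\<lambda>t. Z t \<omega>) b (\<tau> \<omega>)"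
    and u: "0 \<le> u" and a: "0 < a"
  defines "p0 \<equiv> measure (density lborel std_normal_density) {1<..}"
  shows "p0 * prob {\<omega> \<in> space M. u < \<tau> \<omega> \<and> b - Z u \<omega> \<le> a} \<le> prob {\<omega> \<in> space M. u < \<tau> \<omega> \<and> \<tau> \<omega> \<le> u + a\<^sup>2}"
proof -
  have Zm: "Z t \<in> borel_measurable M" if "0 \<le> t" for t
    using Z that by (auto simp: std_brownian_motion_def)
  have [measurable]: "Z u \<in> borel_measurable M" "Z (u + a\<^sup>2) \<in> borel_measurable M"
    using u by (auto intro!: Zm)
  have cont: "AE \<omega> in M. continuous_on {0..} (\<lambda>t. Z t \<omega>)" using Z by (simp add: std_brownian_motion_def)
  let ?F = "process_sigma M (\<lambda>s. Z (min s u))"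
  let ?L = "{\<omega> \<in> space M. stays_below (\<lambda>t. Z t \<omega>) b u \<and> b - Z u \<omega> \<le> a}"
  let ?I = "{\<omega> \<in> space M. Z (u + a\<^sup>2) \<omega> - Z u \<omega> \<in> {a<..}}"
  have L: "?L \<in> sets ?F"
  proof -
    have ZF: "Z t \<in> borel_measurable ?F" if "0 \<le> t" "t \<le> u" for t
      using measurable_process_sigma[OF that(1), of "\<lambda>s. Z (min s u)" M] that(2) by (simp add: min_def)
    have [measurable]: "Z u \<in> borel_measurable ?F" using u by (intro ZF) auto
    have [measurable]: "Measurable.pred ?F (\<lambda>\<omega>. stays_below (\<lambda>t. Z t \<omega>) b u)"
      by (rule pred_stays_below[OF ZF])
    have "{\<omega> \<in> space ?F. stays_below (\<lambda>t. Z t \<omega>) b u \<and> b - Z u \<omega> \<le> a} \<in> sets ?F" by measurable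
    then show ?thesis unfolding space_process_sigma .
  qed
  have sub: "subalgebra M ?F" using u Zm by (intro subalgebra_process_sigma) auto
  have LM: "?L \<in> events" using L sub by (auto simp: subalgebra_def)
  have IM: "?I \<in> events" by measurable
  have "u < u + a\<^sup>2" using a by simp
  then have "distributed M lborel (\<lambda>\<omega>. Z (u + a\<^sup>2) \<omega> - Z u \<omega>) (normal_density 0 (sqrt (u + a\<^sup>2 - u)))"
    using Z u unfolding std_brownian_motion_def by blast
  then have "distributed M lborel (\<lambda>\<omega>. Z (u + a\<^sup>2) \<omega> - Z u \<omega>) (normal_density 0 a)"
    using a by simp
  \<comment> \<open>Dividing by \<open>a\<close>, the standard deviation over time \<open>a\<^sup>2\<close>, gives a probability free of \<open>a\<close>.\<close>
  then have D: "distributed M lborel (\<lambda>\<omega>. (Z (u + a\<^sup>2) \<omega> - Z u \<omega>) / a) std_normal_density"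
    using normal_standard_normal_convert[OF a, of "\<lambda>\<omega>. Z (u + a\<^sup>2) \<omega> - Z u \<omega>" 0] by simp
  have "p0 = measure (distr M lborel (\<lambda>\<omega>. (Z (u + a\<^sup>2) \<omega> - Z u \<omega>) / a)) {1<..}"
    using D unfolding p0_def distributed_def by simp
  also have "\<dots> = prob ((\<lambda>\<omega>. (Z (u + a\<^sup>2) \<omega> - Z u \<omega>) / a) -` {1<..} \<inter> space M)"
    by (rule measure_distr) measurable
  also have "\<dots> = prob ?I"
    using a by (intro arg_cong[where f=prob]) (auto simp: field_simps)
  finally have pI: "p0 = prob ?I" .
  have "prob {\<omega> \<in> space M. u < \<tau> \<omega> \<and> b - Z u \<omega> \<le> a} = prob ?L"
  proof (rule finite_measure_eq_AE)
    show "AE \<omega> in M. (\<omega> \<in> {\<omega> \<in> space M. u < \<tau> \<omega> \<and> b - Z u \<omega> \<le> a}) = (\<omega> \<in> ?L)"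
      using cont fp by eventually_elim (simp add: stays_below_iff[OF _ _ u])
    show "{\<omega> \<in> space M. u < \<tau> \<omega> \<and> b - Z u \<omega> \<le> a} \<in> events" by measurable
    show "?L \<in> events" by (rule LM)
  qed
  then have "p0 * prob {\<omega> \<in> space M. u < \<tau> \<omega> \<and> b - Z u \<omega> \<le> a} = prob (?L \<inter> ?I)"
    using increment_indep_past[OF Z Z0 u _ L, of "a\<^sup>2" "{a<..}"] a unfolding pI by (simp add: mult.commute)
  also have "\<dots> \<le> prob {\<omega> \<in> space M. u < \<tau> \<omega> \<and> \<tau> \<omega> \<le> u + a\<^sup>2}"
  proof (rule finite_measure_mono_AE)
    show "AE \<omega> in M. \<omega> \<in> ?L \<inter> ?I \<longrightarrow> \<omega> \<in> {\<omega> \<in> space M. u < \<tau> \<omega> \<and> \<tau> \<omega> \<le> u + a\<^sup>2}"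
      using cont fp
    proof eventually_elim
      fix \<omega> assume c: "continuous_on {0..} (\<lambda>t. Z t \<omega>)" and f: "first_passage (\<lambda>t. Z t \<omega>) b (\<tau> \<omega>)"
      show "\<omega> \<in> ?L \<inter> ?I \<longrightarrow> \<omega> \<in> {\<omega> \<in> space M. u < \<tau> \<omega> \<and> \<tau> \<omega> \<le> u + a\<^sup>2}"
      proof
        assume \<omega>: "\<omega> \<in> ?L \<inter> ?I"
        then have "u < \<tau> \<omega>" using stays_below_iff[OF c f u] by simp
        moreover have "b < Z (u + a\<^sup>2) \<omega>" using \<omega> by auto
        then have "u + a\<^sup>2 \<notin> {0..<\<tau> \<omega>}" using f unfolding first_passage_def by (meson less_asym)
        then have "\<tau> \<omega> \<le> u + a\<^sup>2" using u by simp
        ultimately show "\<omega> \<in> {\<omega> \<in> space M. u < \<tau> \<omega> \<and> \<tau> \<omega> \<le> u + a\<^sup>2}" using \<omega> by simp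
      qed
    qed
  qed measurable
  finally show ?thesis .
qed

lemma std_normal_upper_tail_pos: "0 < measure (density lborel std_normal_density) {1<..}"
proof -
  interpret N: prob_space "density lborel std_normal_density" by (rule prob_space_normal_density) simp
  have "emeasure (density lborel std_normal_density) {1<..} \<noteq> 0"
  proof
    assume "emeasure (density lborel std_normal_density) {1<..} = 0"
    then have "{1<..} \<in> null_sets (density lborel std_normal_density)" by (simp add: null_sets_def)
    then have "AE x in lborel. x \<in> {1<..} \<longrightarrow> ennreal (std_normal_density x) = 0"
      by (subst (asm) null_sets_density_iff) auto
    moreover have "ennreal (std_normal_density x) \<noteq> 0" for x
      using normal_density_pos[of 1 0 x] by (simp add: ennreal_eq_0_iff not_le)
    ultimately have "AE x in lborel. \<not> (1::real) < x" by simp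
    then have "AE x in lborel. x \<notin> {1<..(2::real)}" by eventually_elim simp
    then have "{1<..(2::real)} \<in> null_sets lborel" by (subst AE_iff_null_sets) auto
    then show False by (simp add: null_sets_def)
  qed
  then show ?thesis by (simp add: N.emeasure_eq_measure measure_nonneg order_less_le)
qed

end

section \<open>Time spent just below the level before the passage\<close>

lemma nn_integral_indicator_section:
  assumes "{y \<in> space M. Q x y} \<in> sets M"
  shows "(\<integral>\<^sup>+y. indicator {(x, y). Q x y} (x, y) \<partial>M) = emeasure M {y \<in> space M. Q x y}"
proof -
  have "(\<integral>\<^sup>+y. indicator {(x, y). Q x y} (x, y) \<partial>M) = (\<integral>\<^sup>+y. indicator {y \<in> space M. Q x y} y \<partial>M)"
    by (rule nn_integral_cong) (simp add: indicator_def)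
  also have "\<dots> = emeasure M {y \<in> space M. Q x y}" by (rule nn_integral_indicator[OF assms])
  finally show ?thesis .
qed

context prob_space
begin

text \<open>
  The passage time is the supremum of the rational times that it exceeds. This gives a version of it that is
  measurable for the \<open>\<sigma>\<close>-algebra of \<open>Z\<close> itself, to which independence from other processes applies.
\<close>

lemma first_passage_version:
  assumes Z: "std_brownian_motion M Z" and fp: "AE \<omega> in M. first_passage (\<lambda>t. Z t \<omega>) b (\<tau> \<omega>)"
  shows "\<exists>\<tau>'\<in>borel_measurable (process_sigma M Z). AE \<omega> in M. \<tau>' \<omega> = \<tau> \<omega>"
proof -
  define f where "f q \<omega> = (if 0 \<le> q \<and> stays_below (\<lambda>t. Z t \<omega>) b (of_rat q) then ennreal (of_rat q) else 0)" for q :: rat and \<omega>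
  have f[measurable]: "f q \<in> borel_measurable (process_sigma M Z)" for q
  proof -
    have [measurable]: "Measurable.pred (process_sigma M Z) (\<lambda>\<omega>. stays_below (\<lambda>t. Z t \<omega>) b (of_rat q))"
      by (rule pred_stays_below[OF measurable_process_sigma])
    show ?thesis unfolding f_def[abs_def] by measurable
  qed
  have sup: "(SUP q. f q \<omega>) = ennreal (\<tau> \<omega>)"
    if c: "continuous_on {0..} (\<lambda>t. Z t \<omega>)" and p: "first_passage (\<lambda>t. Z t \<omega>) b (\<tau> \<omega>)" for \<omega>
  proof (rule SUP_eqI)
    fix q :: rat
    show "f q \<omega> \<le> ennreal (\<tau> \<omega>)"
      unfolding f_def using stays_below_iff[OF c p, of "of_rat q"] by (auto intro!: ennreal_leI)
  next
    fix y assume y: "\<And>q. q \<in> UNIV \<Longrightarrow> f q \<omega> \<le> y"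
    show "ennreal (\<tau> \<omega>) \<le> y"
    proof (rule ccontr)
      assume "\<not> ennreal (\<tau> \<omega>) \<le> y"
      then have less: "y < ennreal (\<tau> \<omega>)" by simp
      then obtain v where v: "y = ennreal v" "0 \<le> v" by (cases y) auto
      then have "v < \<tau> \<omega>" using less by (simp add: ennreal_less_iff)
      then obtain q where q: "v < of_rat q" "of_rat q < \<tau> \<omega>" using of_rat_dense by blast
      then have "0 < (of_rat q :: real)" using v by linarith
      then have "0 \<le> q" by simp
      then have "f q \<omega> = ennreal (of_rat q)"
        unfolding f_def using stays_below_iff[OF c p, of "of_rat q"] q by simp
      then show False using y[of q] q v by (simp add: ennreal_le_iff2 not_le[symmetric])
    qed
  qed
  have "(\<lambda>\<omega>. enn2real (SUP q. f q \<omega>)) \<in> borel_measurable (process_sigma M Z)" by measurable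
  moreover have "AE \<omega> in M. continuous_on {0..} (\<lambda>t. Z t \<omega>)" using Z by (simp add: std_brownian_motion_def)
  then have "AE \<omega> in M. enn2real (SUP q. f q \<omega>) = \<tau> \<omega>"
    using fp
  proof eventually_elim
    case (elim \<omega>)
    have "0 \<le> \<tau> \<omega>" using elim(2) unfolding first_passage_def by blast
    then show ?case unfolding sup[OF elim] by (rule enn2real_ennreal)
  qed
  ultimately show ?thesis by (intro bexI[where x="\<lambda>\<omega>. enn2real (SUP q. f q \<omega>)"])
qed

text \<open>
  By time reversal \<open>u = \<tau> - s\<close>, the left-hand side is the expected time spent within \<open>a\<close> of the level before the
  passage. The estimate \<open>hitting_prob_near_level\<close> is integrated over \<open>u\<close>, and for every outcome the set of
  \<open>u\<close> with \<open>u < \<tau>\<close> and \<open>\<tau> \<le> u + a\<^sup>2\<close> has length \<open>a\<^sup>2\<close>.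
\<close>

lemma occupation_before_passage:
  assumes Z: "std_brownian_motion M Z" and Z0: "\<And>\<omega>. \<omega> \<in> space M \<Longrightarrow> Z 0 \<omega> = 0"
    and \<tau>[measurable]: "\<tau> \<in> borel_measurable M" and fp: "AE \<omega> in M. first_passage (\<lambda>t. Z t \<omega>) b (\<tau> \<omega>)"
    and a: "0 < a"
  defines "p0 \<equiv> measure (density lborel std_normal_density) {1<..}"
  shows "(\<integral>\<^sup>+s. emeasure M {\<omega> \<in> space M. 0 < s \<and> s \<le> \<tau> \<omega> \<and> b - path_eval Z (\<tau> \<omega> - s) \<omega> \<le> a} \<partial>lborel) \<le> ennreal (a\<^sup>2 / p0)"
proof -
  interpret LM: pair_sigma_finite lborel M ..
  have p0: "0 < p0" unfolding p0_def by (rule std_normal_upper_tail_pos)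
  have Zm: "Z t \<in> borel_measurable M" if "0 \<le> t" for t
    using Z that by (auto simp: std_brownian_motion_def)
  have cont: "AE \<omega> in M. continuous_on {0..} (\<lambda>t. Z t \<omega>)" using Z by (simp add: std_brownian_motion_def)
  have path: "(\<lambda>p. path_eval Z (fst p) (snd p)) \<in> borel_measurable (borel \<Otimes>\<^sub>M M)"
    by (rule measurable_path_eval[OF Zm])
  have [measurable]: "(\<lambda>p. path_eval Z (fst p) (snd p)) \<in> borel_measurable (lborel \<Otimes>\<^sub>M M)"
    using path by (simp cong: measurable_cong_sets sets_pair_measure_cong)
  have [measurable]: "(\<lambda>p. path_eval Z (\<tau> (snd p) - fst p) (snd p)) \<in> borel_measurable (lborel \<Otimes>\<^sub>M M)"
    using measurable_compose[OF _ path, of "\<lambda>p. (\<tau> (snd p) - fst p, snd p)" "lborel \<Otimes>\<^sub>M M"] by simp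
  have pu: "path_eval Z u \<in> borel_measurable M" for u
    using measurable_compose[OF _ path, of "\<lambda>\<omega>. (u, \<omega>)" M] by simp
  have mA: "(\<lambda>(s, \<omega>). indicator {(s, \<omega>). 0 < s \<and> s \<le> \<tau> \<omega> \<and> b - path_eval Z (\<tau> \<omega> - s) \<omega> \<le> a} (s, \<omega>) :: ennreal) 
      \<in> borel_measurable (lborel \<Otimes>\<^sub>M M)"
    unfolding indicator_def case_prod_beta mem_Collect_eq fst_conv snd_conv by measurable
  have mB: "(\<lambda>(u, \<omega>). indicator {(u, \<omega>). 0 \<le> u \<and> u < \<tau> \<omega> \<and> b - path_eval Z u \<omega> \<le> a} (u, \<omega>) :: ennreal) 
      \<in> borel_measurable (lborel \<Otimes>\<^sub>M M)"
    unfolding indicator_def case_prod_beta mem_Collect_eq fst_conv snd_conv by measurable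
  have mC: "(\<lambda>(u, \<omega>). indicator {(u, \<omega>). u < \<tau> \<omega> \<and> \<tau> \<omega> \<le> u + a\<^sup>2} (u, \<omega>) :: ennreal) 
      \<in> borel_measurable (lborel \<Otimes>\<^sub>M M)"
    unfolding indicator_def case_prod_beta mem_Collect_eq fst_conv snd_conv by measurable
  have "(\<integral>\<^sup>+s. emeasure M {\<omega> \<in> space M. 0 < s \<and> s \<le> \<tau> \<omega> \<and> b - path_eval Z (\<tau> \<omega> - s) \<omega> \<le> a} \<partial>lborel) =
     (\<integral>\<^sup>+s. \<integral>\<^sup>+\<omega>. indicator {(s, \<omega>). 0 < s \<and> s \<le> \<tau> \<omega> \<and> b - path_eval Z (\<tau> \<omega> - s) \<omega> \<le> a} (s, \<omega>) \<partial>M \<partial>lborel)"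
  proof (rule nn_integral_cong)
    fix s :: real
    have [measurable]: "(\<lambda>\<omega>. path_eval Z (\<tau> \<omega> - s) \<omega>) \<in> borel_measurable M"
      using measurable_compose[OF _ path, of "\<lambda>\<omega>. (\<tau> \<omega> - s, \<omega>)" M] by simp
    show "emeasure M {\<omega> \<in> space M. 0 < s \<and> s \<le> \<tau> \<omega> \<and> b - path_eval Z (\<tau> \<omega> - s) \<omega> \<le> a} =
      (\<integral>\<^sup>+\<omega>. indicator {(s, \<omega>). 0 < s \<and> s \<le> \<tau> \<omega> \<and> b - path_eval Z (\<tau> \<omega> - s) \<omega> \<le> a} (s, \<omega>) \<partial>M)"
      by (rule nn_integral_indicator_section[symmetric]) measurable
  qed
  also have "\<dots> = (\<integral>\<^sup>+\<omega>. \<integral>\<^sup>+s. indicator {(s, \<omega>). 0 < s \<and> s \<le> \<tau> \<omega> \<and> b - path_eval Z (\<tau> \<omega> - s) \<omega> \<le> a} (s, \<omega>) \<partial>lborel \<partial>M)"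
    by (rule LM.Fubini'[OF mA, symmetric])
  also have "\<dots> = (\<integral>\<^sup>+\<omega>. \<integral>\<^sup>+u. indicator {(u, \<omega>). 0 \<le> u \<and> u < \<tau> \<omega> \<and> b - path_eval Z u \<omega> \<le> a} (u, \<omega>) \<partial>lborel \<partial>M)"
  proof (rule nn_integral_cong)
    fix \<omega> assume \<omega>: "\<omega> \<in> space M"
    have m: "(\<lambda>s. indicator {(s, \<omega>). 0 < s \<and> s \<le> \<tau> \<omega> \<and> b - path_eval Z (\<tau> \<omega> - s) \<omega> \<le> a} (s, \<omega>) :: ennreal) \<in> borel_measurable borel"
      using measurable_compose[OF measurable_Pair2'[OF \<omega>] mA] by simp
    show "(\<integral>\<^sup>+s. indicator {(s, \<omega>). 0 < s \<and> s \<le> \<tau> \<omega> \<and> b - path_eval Z (\<tau> \<omega> - s) \<omega> \<le> a} (s, \<omega>) \<partial>lborel)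
      = (\<integral>\<^sup>+u. indicator {(u, \<omega>). 0 \<le> u \<and> u < \<tau> \<omega> \<and> b - path_eval Z u \<omega> \<le> a} (u, \<omega>) \<partial>lborel)"
      using nn_integral_real_affine[OF m, of "-1" "\<tau> \<omega>"]
      by (auto intro!: nn_integral_cong split: split_indicator)
  qed
  also have "\<dots> = (\<integral>\<^sup>+u. \<integral>\<^sup>+\<omega>. indicator {(u, \<omega>). 0 \<le> u \<and> u < \<tau> \<omega> \<and> b - path_eval Z u \<omega> \<le> a} (u, \<omega>) \<partial>M \<partial>lborel)"
    by (rule LM.Fubini'[OF mB])
  also have "\<dots> \<le> (\<integral>\<^sup>+u. ennreal (1 / p0) * (\<integral>\<^sup>+\<omega>. indicator {(u, \<omega>). u < \<tau> \<omega> \<and> \<tau> \<omega> \<le> u + a\<^sup>2} (u, \<omega>) \<partial>M) \<partial>lborel)"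
  proof (rule nn_integral_mono)
    fix u :: real
    have pc: "(\<integral>\<^sup>+\<omega>. indicator {(u, \<omega>). u < \<tau> \<omega> \<and> \<tau> \<omega> \<le> u + a\<^sup>2} (u, \<omega>) \<partial>M) = 
       ennreal (prob {\<omega> \<in> space M. u < \<tau> \<omega> \<and> \<tau> \<omega> \<le> u + a\<^sup>2})"
      unfolding emeasure_eq_measure[symmetric]
      by (rule nn_integral_indicator_section) measurable
    show "(\<integral>\<^sup>+\<omega>. indicator {(u, \<omega>). 0 \<le> u \<and> u < \<tau> \<omega> \<and> b - path_eval Z u \<omega> \<le> a} (u, \<omega>) \<partial>M)
      \<le> ennreal (1 / p0) * (\<integral>\<^sup>+\<omega>. indicator {(u, \<omega>). u < \<tau> \<omega> \<and> \<tau> \<omega> \<le> u + a\<^sup>2} (u, \<omega>) \<partial>M)"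
    proof (cases "0 \<le> u")
      case True
      have [measurable]: "Z u \<in> borel_measurable M" using Zm True .
      have "(\<integral>\<^sup>+\<omega>. indicator {(u, \<omega>). 0 \<le> u \<and> u < \<tau> \<omega> \<and> b - path_eval Z u \<omega> \<le> a} (u, \<omega>) \<partial>M)
        = (\<integral>\<^sup>+\<omega>. indicator {\<omega> \<in> space M. u < \<tau> \<omega> \<and> b - Z u \<omega> \<le> a} \<omega> \<partial>M)"
      proof (rule nn_integral_cong_AE)
        show "AE \<omega> in M. indicator {(u, \<omega>). 0 \<le> u \<and> u < \<tau> \<omega> \<and> b - path_eval Z u \<omega> \<le> a} (u, \<omega>)
          = (indicator {\<omega> \<in> space M. u < \<tau> \<omega> \<and> b - Z u \<omega> \<le> a} \<omega> :: ennreal)"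
          using cont AE_space by eventually_elim (use path_eval_eq[where X=Z, OF _ True] True in \<open>simp add: indicator_def\<close>)
      qed
      also have "\<dots> = ennreal (prob {\<omega> \<in> space M. u < \<tau> \<omega> \<and> b - Z u \<omega> \<le> a})"
        unfolding emeasure_eq_measure[symmetric] by (rule nn_integral_indicator) measurable
      also have "\<dots> \<le> ennreal (1 / p0 * prob {\<omega> \<in> space M. u < \<tau> \<omega> \<and> \<tau> \<omega> \<le> u + a\<^sup>2})"
        using hitting_prob_near_level[OF Z Z0 \<tau> fp True a] p0 unfolding p0_def[symmetric]
        by (intro ennreal_leI) (simp add: field_simps)
      also have "\<dots> = ennreal (1 / p0) * ennreal (prob {\<omega> \<in> space M. u < \<tau> \<omega> \<and> \<tau> \<omega> \<le> u + a\<^sup>2})"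
        using p0 by (intro ennreal_mult) auto
      finally show ?thesis unfolding pc .
    qed simp
  qed
  also have "\<dots> = ennreal (1 / p0) * (\<integral>\<^sup>+u. \<integral>\<^sup>+\<omega>. indicator {(u, \<omega>). u < \<tau> \<omega> \<and> \<tau> \<omega> \<le> u + a\<^sup>2} (u, \<omega>) \<partial>M \<partial>lborel)"
    using borel_measurable_nn_integral_fst[OF mC] by (intro nn_integral_cmult) simp
  also have "(\<integral>\<^sup>+u. \<integral>\<^sup>+\<omega>. indicator {(u, \<omega>). u < \<tau> \<omega> \<and> \<tau> \<omega> \<le> u + a\<^sup>2} (u, \<omega>) \<partial>M \<partial>lborel) =
    (\<integral>\<^sup>+\<omega>. \<integral>\<^sup>+u. indicator {(u, \<omega>). u < \<tau> \<omega> \<and> \<tau> \<omega> \<le> u + a\<^sup>2} (u, \<omega>) \<partial>lborel \<partial>M)"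
    by (rule LM.Fubini'[OF mC, symmetric])
  also have "\<dots> = (\<integral>\<^sup>+\<omega>. ennreal (a\<^sup>2) \<partial>M)"
  proof (rule nn_integral_cong)
    fix \<omega>
    have "(\<integral>\<^sup>+u. indicator {(u, \<omega>). u < \<tau> \<omega> \<and> \<tau> \<omega> \<le> u + a\<^sup>2} (u, \<omega>) \<partial>lborel) = (\<integral>\<^sup>+u. indicator {\<tau> \<omega> - a\<^sup>2..<\<tau> \<omega>} u \<partial>lborel)"
      by (intro nn_integral_cong) (auto split: split_indicator)
    then show "(\<integral>\<^sup>+u. indicator {(u, \<omega>). u < \<tau> \<omega> \<and> \<tau> \<omega> \<le> u + a\<^sup>2} (u, \<omega>) \<partial>lborel) = ennreal (a\<^sup>2)"
      by simp
  qed
  also have "ennreal (1 / p0) * (\<integral>\<^sup>+\<omega>. ennreal (a\<^sup>2) \<partial>M) = ennreal (a\<^sup>2 / p0)"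
    using p0 by (simp add: emeasure_space_1 ennreal_mult[symmetric])
  finally show ?thesis .
qed

text \<open>
  If every scale in \<open>[r, 2 r]\<close> were bad, the occupation integral would be at least \<open>r\<close> times the
  claimed bound, which is twice what \<open>occupation_before_passage\<close> permits.
\<close>

lemma exists_scale_away_from_level:
  assumes Z: "std_brownian_motion M Z" and Z0: "\<And>\<omega>. \<omega> \<in> space M \<Longrightarrow> Z 0 \<omega> = 0"
    and \<tau>: "\<tau> \<in> borel_measurable M" and fp: "AE \<omega> in M. first_passage (\<lambda>t. Z t \<omega>) b (\<tau> \<omega>)"
    and a: "0 < a" and r: "0 < r"
  defines "p0 \<equiv> measure (density lborel std_normal_density) {1<..}"
  shows "\<exists>s. r \<le> s \<and> s \<le> 2 * r \<and> prob {\<omega> \<in> space M. s \<le> \<tau> \<omega> \<and> b - path_eval Z (\<tau> \<omega> - s) \<omega> \<le> a} \<le> 2 * a\<^sup>2 / (p0 * r)"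
proof (rule ccontr)
  assume "\<not> ?thesis"
  then have big: "2 * a\<^sup>2 / (p0 * r) < prob {\<omega> \<in> space M. s \<le> \<tau> \<omega> \<and> b - path_eval Z (\<tau> \<omega> - s) \<omega> \<le> a}"
    if "s \<in> {r..2 * r}" for s using that by (meson atLeastAtMost_iff not_le)
  have p0: "0 < p0" unfolding p0_def by (rule std_normal_upper_tail_pos)
  have "ennreal (2 * a\<^sup>2 / p0) = ennreal (2 * a\<^sup>2 / (p0 * r)) * ennreal r"
    using p0 r by (simp add: ennreal_mult[symmetric])
  also have "\<dots> = (\<integral>\<^sup>+s. ennreal (2 * a\<^sup>2 / (p0 * r)) * indicator {r..2 * r} s \<partial>lborel)"
    using r by (simp add: nn_integral_cmult)
  also have "\<dots> \<le> (\<integral>\<^sup>+s. emeasure M {\<omega> \<in> space M. 0 < s \<and> s \<le> \<tau> \<omega> \<and> b - path_eval Z (\<tau> \<omega> - s) \<omega> \<le> a} \<partial>lborel)"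
  proof (rule nn_integral_mono)
    fix s :: real
    show "ennreal (2 * a\<^sup>2 / (p0 * r)) * indicator {r..2 * r} s
      \<le> emeasure M {\<omega> \<in> space M. 0 < s \<and> s \<le> \<tau> \<omega> \<and> b - path_eval Z (\<tau> \<omega> - s) \<omega> \<le> a}"
    proof (cases "s \<in> {r..2 * r}")
      case True
      then have "0 < s" using r by simp
      then show ?thesis using big[OF True] True by (simp add: emeasure_eq_measure ennreal_leI)
    qed simp
  qed
  also have "\<dots> \<le> ennreal (a\<^sup>2 / p0)"
    unfolding p0_def by (rule occupation_before_passage[OF Z Z0 \<tau> fp a])
  finally have "2 * a\<^sup>2 / p0 \<le> a\<^sup>2 / p0" using p0 by (simp add: ennreal_le_iff)
  then show False using p0 a by (simp add: field_simps)
qed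

end

section \<open>Hitting times and regular conditional distributions\<close>

text \<open>
  The hitting set is closed, so its infimum is attained. A path starting below \<open>b\<close> that exceeded \<open>b\<close>
  earlier would have crossed it earlier, by the intermediate value theorem.
\<close>

lemma first_passage_Inf:
  fixes z :: "real \<Rightarrow> real"
  assumes cont: "continuous_on {0..} z" and z0: "z 0 < b"
    and fin: "\<bar>Inf {ereal t |t. 0 \<le> t \<and> z t = b}\<bar> \<noteq> \<infinity>" (is "\<bar>Inf ?E\<bar> \<noteq> \<infinity>")
  shows "first_passage z b (real_of_ereal (Inf {ereal t |t. 0 \<le> t \<and> z t = b}))"
    and "0 < real_of_ereal (Inf {ereal t |t. 0 \<le> t \<and> z t = b})"
proof -
  define S where "S = {t \<in> {0..}. z t \<in> {b}}"
  have S_iff: "t \<in> S \<longleftrightarrow> 0 \<le> t \<and> z t = b" for t by (simp add: S_def)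
  have E: "?E = ereal ` S" by (auto simp: S_iff)
  have "S \<noteq> {}"
  proof
    assume "S = {}"
    then have "Inf ?E = \<infinity>" unfolding E by (simp add: top_ereal_def)
    then show False using fin by simp
  qed
  moreover have "closed S"
    unfolding S_def using continuous_closed_preimage[OF cont, of "{b}"] by (simp add: vimage_def Int_def)
  moreover have bdd: "bdd_below S" by (rule bdd_belowI[of _ 0]) (simp add: S_iff)
  ultimately have inS: "Inf S \<in> S" by (simp add: closed_contains_Inf)
  have "Inf ?E = ereal (Inf S)" unfolding E
  proof (rule antisym)
    show "Inf (ereal ` S) \<le> ereal (Inf S)" using inS by (rule INF_lower)
    show "ereal (Inf S) \<le> Inf (ereal ` S)" using cInf_lower[OF _ bdd] by (intro INF_greatest) simp
  qed
  then have T: "real_of_ereal (Inf ?E) = Inf S" by simp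
  have below: "z u < b" if u: "0 \<le> u" "u < Inf S" for u
  proof (rule ccontr)
    assume "\<not> z u < b"
    moreover have "continuous_on {0..u} z" using cont by (rule continuous_on_subset) auto
    ultimately obtain x where x: "0 \<le> x" "x \<le> u" "z x = b"
      using IVT'[of z 0 b u] z0 u by auto
    then have "Inf S \<le> x" using cInf_lower[OF _ bdd, of x] by (simp add: S_iff)
    then show False using x u by simp
  qed
  show "first_passage z b (real_of_ereal (Inf ?E))"
    unfolding T first_passage_def using inS below by (simp add: S_iff)
  have "Inf S \<noteq> 0" using inS z0 by (auto simp: S_iff)
  then show "0 < real_of_ereal (Inf ?E)" unfolding T using inS by (simp add: S_iff)
qed

lemma mem_ereal_image_iff: "x \<in> ereal ` A \<longleftrightarrow> \<bar>x\<bar> \<noteq> \<infinity> \<and> real_of_ereal x \<in> A"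
  by (cases x) auto

context prob_space
begin

lemma AE_eventually_not_of_summable_bound:
  assumes Q: "\<And>m. {\<omega> \<in> space M. Q m \<omega>} \<in> events"
    and bound: "\<And>m. prob {\<omega> \<in> space M. Q m \<omega>} \<le> K / (real (Suc m))\<^sup>2"
  shows "AE \<omega> in M. eventually (\<lambda>m. \<not> Q m \<omega>) sequentially"
proof -
  have "summable (\<lambda>m. inverse (real (Suc m) ^ 2))"
    using inverse_power_summable[of 2, where 'a=real] by (subst summable_Suc_iff) simp
  then have "summable (\<lambda>m. K * inverse (real (Suc m) ^ 2))" by (rule summable_mult)
  then have "summable (\<lambda>m. prob {\<omega> \<in> space M. Q m \<omega>})"
    by (rule summable_comparison_test') (use bound in \<open>simp add: divide_inverse\<close>)
  then have "AE \<omega> in M. eventually (\<lambda>m. \<omega> \<in> space M - {\<omega> \<in> space M. Q m \<omega>}) sequentially"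
    using Q by (intro borel_cantelli_AE1) (simp_all add: emeasure_eq_measure)
  then show ?thesis
    by eventually_elim (auto elim: eventually_mono)
qed

text \<open>
  A conditional distribution that is a probability measure on the reals leaves no mass for infinite
  values.
\<close>

lemma regular_cond_distr_finite:
  assumes D: "regular_cond_distr M F T D"
  shows "AE \<omega> in M. \<bar>T \<omega>\<bar> \<noteq> \<infinity>"
proof -
  have sub: "subalgebra M F" and T[measurable]: "T \<in> borel_measurable M" 
    and Dm: "D \<in> measurable F (prob_algebra borel)"
    using D by (auto simp: regular_cond_distr_def)
  interpret F: finite_measure_subalgebra M F by unfold_locales (rule sub)
  let ?f = "indicator {\<omega> \<in> space M. T \<omega> \<in> ereal ` UNIV} :: 'a \<Rightarrow> real"
  have set: "{\<omega> \<in> space M. T \<omega> \<in> ereal ` UNIV} \<in> events" unfolding mem_ereal_image_iff by measurable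
  have int: "integrable M ?f" using set by (simp add: emeasure_eq_measure)
  have "\<forall>A\<in>sets borel. AE \<omega> in M. measure (D \<omega>) A = real_cond_exp M F (indicator {\<omega> \<in> space M. T \<omega> \<in> ereal ` A}) \<omega>"
    using D unfolding regular_cond_distr_def by (elim conjE)
  then have aeD: "AE \<omega> in M. measure (D \<omega>) UNIV = real_cond_exp M F ?f \<omega>"
    by (rule bspec) simp
  have D1: "measure (D \<omega>) UNIV = 1" if "\<omega> \<in> space M" for \<omega>
  proof -
    have "D \<omega> \<in> space (prob_algebra borel)" 
      using measurable_space[OF Dm] that sub by (simp add: subalgebra_def)
    then have "prob_space (D \<omega>)" "space (D \<omega>) = UNIV" 
      by (auto simp: space_prob_algebra dest: sets_eq_imp_space_eq)
    then show ?thesis using prob_space.prob_space by metis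
  qed
  have "AE \<omega> in M. real_cond_exp M F ?f \<omega> = 1"
    using aeD AE_space
  proof eventually_elim
    case (elim \<omega>)
    show ?case unfolding elim(1)[symmetric] by (rule D1[OF elim(2)])
  qed
  then have "expectation (real_cond_exp M F ?f) = expectation (\<lambda>_. 1)"
    by (intro integral_cong_AE) auto
  then have "prob {\<omega> \<in> space M. T \<omega> \<in> ereal ` UNIV} = 1"
    using F.real_cond_exp_int(2)[OF int] set by (simp add: prob_space)
  then have "AE \<omega> in M. \<omega> \<in> {\<omega> \<in> space M. T \<omega> \<in> ereal ` UNIV}"
    using set by (simp add: prob_eq_1)
  then show ?thesis by eventually_elim auto
qed

lemma regular_cond_distr_rectangle:
  assumes D: "regular_cond_distr M F T D" and E: "E \<in> sets F" and A: "A \<in> sets borel"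
  shows "(\<integral>\<^sup>+\<omega>. emeasure (D \<omega>) A * indicator E \<omega> \<partial>M) = emeasure M {\<omega> \<in> E. T \<omega> \<in> ereal ` A}"
proof -
  have sub: "subalgebra M F" and T[measurable]: "T \<in> borel_measurable M" 
    and Dm: "D \<in> measurable F (prob_algebra borel)"
    using D by (auto simp: regular_cond_distr_def)
  have DM: "D \<in> measurable M (prob_algebra borel)" by (rule measurable_from_subalg[OF sub Dm])
  have mD: "(\<lambda>\<omega>. measure (D \<omega>) A) \<in> borel_measurable M"
    by (rule measurable_compose[OF DM measurable_measure_prob_algebra[OF A]])
  have EM: "E \<in> events" "E \<subseteq> space M"
    using E sub sets.sets_into_space[OF E] by (auto simp: subalgebra_def)
  interpret F: finite_measure_subalgebra M F by unfold_locales (rule sub)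
  note A[measurable] EM(1)[measurable]
  let ?f = "indicator {\<omega> \<in> space M. T \<omega> \<in> ereal ` A} :: 'a \<Rightarrow> real"
  have set: "{\<omega> \<in> space M. T \<omega> \<in> ereal ` A} \<in> events" unfolding mem_ereal_image_iff by measurable
  have int: "integrable M ?f" using set by (simp add: emeasure_eq_measure)
  have D1: "prob_space (D \<omega>)" if "\<omega> \<in> space M" for \<omega>
    using measurable_space[OF DM that] by (simp add: space_prob_algebra)
  have "\<forall>A\<in>sets borel. AE \<omega> in M. measure (D \<omega>) A = real_cond_exp M F (indicator {\<omega> \<in> space M. T \<omega> \<in> ereal ` A}) \<omega>"
    using D unfolding regular_cond_distr_def by (elim conjE)
  then have ae: "AE \<omega> in M. measure (D \<omega>) A = real_cond_exp M F ?f \<omega>"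
    by (rule bspec) (rule A)
  have iD: "integrable M (\<lambda>\<omega>. indicator E \<omega> * measure (D \<omega>) A)"
  proof (rule integrable_const_bound[where B=1])
    show "AE \<omega> in M. norm (indicator E \<omega> * measure (D \<omega>) A) \<le> 1"
      using prob_space.prob_le_1[OF D1] by (intro AE_I2) (auto simp: indicator_def)
  qed (use mD in measurable)
  have "(\<integral>\<^sup>+\<omega>. emeasure (D \<omega>) A * indicator E \<omega> \<partial>M) = (\<integral>\<^sup>+\<omega>. ennreal (indicator E \<omega> * measure (D \<omega>) A) \<partial>M)"
  proof (rule nn_integral_cong)
    fix \<omega> assume "\<omega> \<in> space M"
    then interpret D: prob_space "D \<omega>" by (rule D1)
    show "emeasure (D \<omega>) A * indicator E \<omega> = ennreal (indicator E \<omega> * measure (D \<omega>) A)"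
      by (simp add: D.emeasure_eq_measure indicator_def)
  qed
  also have "\<dots> = ennreal (\<integral>\<omega>. indicator E \<omega> * measure (D \<omega>) A \<partial>M)"
    by (rule nn_integral_eq_integral[OF iD]) simp
  also have "(\<integral>\<omega>. indicator E \<omega> * measure (D \<omega>) A \<partial>M) = (\<integral>\<omega>. indicator E \<omega> * real_cond_exp M F ?f \<omega> \<partial>M)"
  proof (rule integral_cong_AE)
    show "AE \<omega> in M. indicator E \<omega> * measure (D \<omega>) A = indicator E \<omega> * real_cond_exp M F ?f \<omega>"
      using ae by eventually_elim simp
  qed (use mD in measurable)
  also have "\<dots> = (\<integral>\<omega>\<in>E. ?f \<omega> \<partial>M)"
    using F.real_cond_exp_intA[OF int E] by (simp add: set_lebesgue_integral_def)
  also have "\<dots> = (\<integral>\<omega>. indicator {\<omega> \<in> E. T \<omega> \<in> ereal ` A} \<omega> \<partial>M)"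
    unfolding set_lebesgue_integral_def using EM(2) by (intro Bochner_Integration.integral_cong) (auto simp: indicator_def)
  also have "\<dots> = prob {\<omega> \<in> E. T \<omega> \<in> ereal ` A}"
  proof -
    have "{\<omega> \<in> E. T \<omega> \<in> ereal ` A} = {\<omega> \<in> space M. T \<omega> \<in> ereal ` A} \<inter> E" using EM(2) by blast
    then have "{\<omega> \<in> E. T \<omega> \<in> ereal ` A} \<in> events" using set EM(1) by simp
    then show ?thesis by simp
  qed
  finally show ?thesis by (simp add: emeasure_eq_measure)
qed

text \<open>
  The joint law of \<open>(\<omega>, \<tau> \<omega>)\<close> on \<open>F\<close> times the Borel sets is the law of \<open>\<omega>\<close> composed with the kernel \<open>D\<close>: both
  agree on rectangles. A property that holds almost surely for the joint law thus holds for
  \<open>D \<omega>\<close>-almost every \<open>t\<close>, for almost every \<open>\<omega>\<close>.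
\<close>

lemma AE_regular_cond_distr:
  assumes D: "regular_cond_distr M F T D" and \<tau>[measurable]: "\<tau> \<in> borel_measurable M"
    and T\<tau>: "AE \<omega> in M. T \<omega> = ereal (\<tau> \<omega>)"
    and P[measurable]: "Measurable.pred (F \<Otimes>\<^sub>M borel) P" and ae: "AE \<omega> in M. P (\<omega>, \<tau> \<omega>)"
  shows "AE \<omega> in M. AE t in D \<omega>. P (\<omega>, t)"
proof -
  have sub: "subalgebra M F" and T[measurable]: "T \<in> borel_measurable M" 
    and Dm: "D \<in> measurable F (prob_algebra borel)"
    using D by (auto simp: regular_cond_distr_def)
  have DM: "D \<in> measurable M (prob_algebra borel)" by (rule measurable_from_subalg[OF sub Dm])
  have spF: "space F = space M" using sub by (simp add: subalgebra_def)
  have idF: "(\<lambda>\<omega>. \<omega>) \<in> measurable M F" by (rule measurable_from_subalg[OF sub]) simp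
  let ?G = "F \<Otimes>\<^sub>M (borel :: real measure)"
  have Pair\<tau>: "(\<lambda>\<omega>. (\<omega>, \<tau> \<omega>)) \<in> measurable M ?G" by (rule measurable_Pair[OF idF \<tau>])
  define \<mu> where "\<mu> = distr M ?G (\<lambda>\<omega>. (\<omega>, \<tau> \<omega>))"
  define K where "K \<omega> = distr (D \<omega>) ?G (\<lambda>t. (\<omega>, t))" for \<omega>
  have K: "K \<in> measurable M (prob_algebra ?G)"
    unfolding K_def
  proof (rule measurable_distr_prob_space2[OF DM])
    show "(\<lambda>(\<omega>, t). (\<omega>, t)) \<in> measurable (M \<Otimes>\<^sub>M borel) ?G"
      unfolding case_prod_beta by (rule measurable_Pair[OF measurable_compose[OF measurable_fst idF] measurable_snd])
  qed
  then have K': "K \<in> measurable M (subprob_algebra ?G)" by (rule measurable_prob_algebraD)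
  have D_sets: "sets (D \<omega>) = sets borel" if "\<omega> \<in> space M" for \<omega>
    using measurable_space[OF DM that] by (auto simp: space_prob_algebra)
  have KP: "(\<lambda>t. (\<omega>, t)) \<in> measurable (D \<omega>) ?G" if "\<omega> \<in> space M" for \<omega>
    using measurable_Pair1'[of \<omega> F "borel :: real measure"] that spF D_sets[OF that]
    by (simp cong: measurable_cong_sets)
  have \<mu>_eq: "\<mu> = M \<bind> K"
  proof (rule measure_eqI_generator_eq[where \<Omega>="space M \<times> UNIV" and E="{a \<times> b | a b. a \<in> sets F \<and> b \<in> sets borel}"
        and A="\<lambda>_. space M \<times> UNIV"])
    show "Int_stable {a \<times> b | a b. a \<in> sets F \<and> b \<in> sets (borel :: real measure)}"
      by (rule Int_stable_pair_measure_generator)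
    show "{a \<times> b | a b. a \<in> sets F \<and> b \<in> sets (borel :: real measure)} \<subseteq> Pow (space M \<times> UNIV)"
      using sets.space_closed[of F] spF by auto
    show "sets \<mu> = sigma_sets (space M \<times> UNIV) {a \<times> b | a b. a \<in> sets F \<and> b \<in> sets borel}"
      unfolding \<mu>_def sets_distr sets_pair_measure spF by simp
    show "sets (M \<bind> K) = sigma_sets (space M \<times> UNIV) {a \<times> b | a b. a \<in> sets F \<and> b \<in> sets borel}"
      using sets_bind[OF sets_kernel[OF K'] not_empty] unfolding sets_pair_measure spF by simp
    show "range (\<lambda>_. space M \<times> UNIV) \<subseteq> {a \<times> b | a b. a \<in> sets F \<and> b \<in> sets (borel :: real measure)}"
    proof -
      have "space M \<times> (UNIV :: real set) \<in> {a \<times> b | a b. a \<in> sets F \<and> b \<in> sets (borel :: real measure)}"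
        using sets.top[of F, unfolded spF] by (intro CollectI exI[of _ "space M"] exI[of _ UNIV]) simp
      then show ?thesis by blast
    qed
    show "(\<Union>i::nat. space M \<times> (UNIV :: real set)) = space M \<times> UNIV" by simp
    interpret \<mu>: prob_space \<mu> unfolding \<mu>_def by (rule prob_space_distr[OF Pair\<tau>])
    show "emeasure \<mu> (space M \<times> UNIV) \<noteq> \<infinity>" by (simp add: \<mu>.emeasure_eq_measure)
    fix X assume "X \<in> {a \<times> b | a b. a \<in> sets F \<and> b \<in> sets (borel :: real measure)}"
    then obtain E A where X: "X = E \<times> A" and E: "E \<in> sets F" and A: "A \<in> sets borel" by blast
    have XG: "X \<in> sets ?G" unfolding X using E A by (rule pair_measureI)
    have EM: "E \<in> events" "E \<subseteq> space M"
      using E sub sets.sets_into_space[OF E] by (auto simp: subalgebra_def)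
    have "emeasure (M \<bind> K) X = (\<integral>\<^sup>+\<omega>. emeasure (K \<omega>) X \<partial>M)"
      by (rule emeasure_bind[OF not_empty K' XG])
    also have "\<dots> = (\<integral>\<^sup>+\<omega>. emeasure (D \<omega>) A * indicator E \<omega> \<partial>M)"
    proof (rule nn_integral_cong)
      fix \<omega> assume \<omega>: "\<omega> \<in> space M"
      have "emeasure (K \<omega>) X = emeasure (D \<omega>) ((\<lambda>t. (\<omega>, t)) -` X \<inter> space (D \<omega>))"
        unfolding K_def by (rule emeasure_distr[OF KP[OF \<omega>] XG])
      also have "(\<lambda>t. (\<omega>, t)) -` X \<inter> space (D \<omega>) = (if \<omega> \<in> E then A else {})"
        using sets_eq_imp_space_eq[OF D_sets[OF \<omega>]] by (auto simp: X)
      finally show "emeasure (K \<omega>) X = emeasure (D \<omega>) A * indicator E \<omega>" by simp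
    qed
    also have "\<dots> = emeasure M {\<omega> \<in> E. T \<omega> \<in> ereal ` A}"
      by (rule regular_cond_distr_rectangle[OF D E A])
    also have "\<dots> = emeasure M ((\<lambda>\<omega>. (\<omega>, \<tau> \<omega>)) -` X \<inter> space M)"
    proof (rule emeasure_eq_AE)
      show "AE \<omega> in M. (\<omega> \<in> {\<omega> \<in> E. T \<omega> \<in> ereal ` A}) = (\<omega> \<in> (\<lambda>\<omega>. (\<omega>, \<tau> \<omega>)) -` X \<inter> space M)"
        using T\<tau> AE_space by eventually_elim (auto simp: X)
      have "{\<omega> \<in> E. T \<omega> \<in> ereal ` A} = {\<omega> \<in> space M. T \<omega> \<in> ereal ` A} \<inter> E" using EM(2) by blast
      moreover have "{\<omega> \<in> space M. T \<omega> \<in> ereal ` A} \<in> events"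
        using A unfolding mem_ereal_image_iff by measurable
      ultimately show "{\<omega> \<in> E. T \<omega> \<in> ereal ` A} \<in> events" using EM(1) by simp
      show "(\<lambda>\<omega>. (\<omega>, \<tau> \<omega>)) -` X \<inter> space M \<in> events" by (rule measurable_sets[OF Pair\<tau> XG])
    qed
    also have "\<dots> = emeasure \<mu> X"
      unfolding \<mu>_def by (rule emeasure_distr[OF Pair\<tau> XG, symmetric])
    finally show "emeasure \<mu> X = emeasure (M \<bind> K) X" by simp
  qed
  have "AE p in \<mu>. P p"
    unfolding \<mu>_def by (subst AE_distr_iff[OF Pair\<tau>]) (use ae P in \<open>simp_all add: pred_def\<close>)
  then have "AE p in M \<bind> K. P p" unfolding \<mu>_eq .
  then have "AE \<omega> in M. AE p in K \<omega>. P p"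
    by (subst (asm) AE_bind[OF K' P])
  then show ?thesis
    using AE_space
  proof eventually_elim
    case (elim \<omega>)
    show "AE t in D \<omega>. P (\<omega>, t)"
      using elim(1) unfolding K_def by (rule AE_distrD[OF KP[OF elim(2)]])
  qed
qed

end

section \<open>Scale averages at independent times and at the passage time\<close>

lemma scale_average_cong:
  assumes "\<And>u. 0 \<le> u \<Longrightarrow> x u = y u" "\<And>k. k < N \<Longrightarrow> s k \<le> t" "0 \<le> t"
  shows "scale_average x N s t = scale_average y N s t"
  unfolding scale_average_def using assms by (intro arg_cong2[where f="(/)"] sum.cong) auto

lemma scale_average_affine:
  "scale_average (\<lambda>u. w + (y u - \<sigma> * z u) / \<kappa>) N s t = (scale_average y N s t - \<sigma> * scale_average z N s t) / \<kappa>"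
proof -
  have "(\<Sum>k<N. (w + (y (t - s k) - \<sigma> * z (t - s k)) / \<kappa> - (w + (y t - \<sigma> * z t) / \<kappa>)) / sqrt (s k)) =
    (\<Sum>k<N. ((y (t - s k) - y t) / sqrt (s k) - \<sigma> * ((z (t - s k) - z t) / sqrt (s k))) / \<kappa>)"
    by (intro sum.cong refl) (simp add: diff_divide_distrib add_divide_distrib right_diff_distrib mult.commute[of \<kappa>])
  also have "\<dots> = ((\<Sum>k<N. (y (t - s k) - y t) / sqrt (s k)) - \<sigma> * (\<Sum>k<N. (z (t - s k) - z t) / sqrt (s k))) / \<kappa>"
    by (simp only: sum_divide_distrib[symmetric] sum_subtractf sum_distrib_left[symmetric])
  finally have sum_eq: "(\<Sum>k<N. (w + (y (t - s k) - \<sigma> * z (t - s k)) / \<kappa> - (w + (y t - \<sigma> * z t) / \<kappa>)) / sqrt (s k)) =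
    ((\<Sum>k<N. (y (t - s k) - y t) / sqrt (s k)) - \<sigma> * (\<Sum>k<N. (z (t - s k) - z t) / sqrt (s k))) / \<kappa>" .
  have "(p - \<sigma> * q) / \<kappa> / n = (p / n - \<sigma> * (q / n)) / \<kappa>" for p q n
    by (simp add: diff_divide_distrib mult.commute)
  then show ?thesis unfolding scale_average_def sum_eq .
qed

text \<open>
  The factor \<open>2\<close> leaves room for choosing each scale
  well; letting the largest scale tend to \<open>0\<close> makes the averages meaningful at every positive time.
\<close>

definition fine_scales :: "(nat \<Rightarrow> nat \<Rightarrow> real) \<Rightarrow> bool" where
  "fine_scales s \<longleftrightarrow> (\<forall>m k. (1 / 4 ^ m) / 4 ^ k \<le> s m k \<and> s m k \<le> 2 * (1 / 4 ^ m) / 4 ^ k)"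

lemma fine_scales_le:
  assumes "fine_scales s" shows "s m k \<le> 2 * (1 / 4 ^ m)"
proof -
  have "s m k \<le> 2 * (1 / 4 ^ m) / 4 ^ k" using assms by (simp add: fine_scales_def)
  also have "\<dots> \<le> 2 * (1 / 4 ^ m) / 1" by (intro divide_left_mono) auto
  finally show ?thesis by simp
qed

lemma fine_scales_pos:
  assumes "fine_scales s" shows "0 < s m k"
proof -
  have "0 < (1 / 4 ^ m) / (4 ^ k :: real)" by simp
  also have "\<dots> \<le> s m k" using assms by (simp add: fine_scales_def)
  finally show ?thesis .
qed

lemma eventually_scale_le:
  assumes "0 < (t::real)"
  shows "eventually (\<lambda>m. 2 * (1 / 4 ^ m) \<le> t) sequentially"
proof -
  have "(\<lambda>m. 2 * (1 / 4) ^ m :: real) \<longlonglongrightarrow> 2 * 0"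
    by (intro tendsto_mult tendsto_const LIMSEQ_realpow_zero) auto
  then have "eventually (\<lambda>m. 2 * (1 / 4) ^ m < t) sequentially"
    using assms by (intro order_tendstoD(2)) auto
  then show ?thesis by eventually_elim (simp add: power_one_over)
qed

context prob_space
begin

lemma indep_set_commute:
  assumes "indep_set A B"
  shows "indep_set B A"
  unfolding indep_sets2_eq
proof (intro conjI ballI)
  show "B \<subseteq> events" "A \<subseteq> events"
    by (rule indep_setD_ev2[OF assms], rule indep_setD_ev1[OF assms])
  fix b a assume "b \<in> B" "a \<in> A"
  with indep_setD[OF assms] show "prob (b \<inter> a) = prob b * prob a"
    by (simp add: Int_commute mult.commute)
qed

text \<open>
  Fubini for a variable independent of a \<open>\<sigma>\<close>-algebra: in a jointly measurable expression the
  variable may be frozen.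
\<close>

lemma nn_integral_indep_sigma:
  assumes ind: "indep_set (sets F) (sets G)" and sp: "space F = space M" "space G = space M"
    and XF: "X \<in> measurable F S" and f: "f \<in> borel_measurable (S \<Otimes>\<^sub>M G)"
  shows "(\<integral>\<^sup>+\<omega>. f (X \<omega>, \<omega>) \<partial>M) = (\<integral>\<^sup>+\<omega>. \<integral>\<^sup>+\<omega>'. f (X \<omega>, \<omega>') \<partial>M \<partial>M)"
proof -
  have sub: "subalgebra M F" "subalgebra M G"
    using indep_setD_ev1[OF ind] indep_setD_ev2[OF ind] sp by (auto simp: subalgebra_def)
  have X: "X \<in> measurable M S" by (rule measurable_from_subalg[OF sub(1) XF])
  have Y: "(\<lambda>\<omega>. \<omega>) \<in> measurable M G" by (rule measurable_from_subalg[OF sub(2)]) simp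
  let ?P = "distr M S X" and ?Q = "distr M G (\<lambda>\<omega>. \<omega>)"
  interpret P: prob_space ?P by (rule prob_space_distr[OF X])
  interpret Q: prob_space ?Q by (rule prob_space_distr[OF Y])
  have XY: "(\<lambda>\<omega>. (X \<omega>, \<omega>)) \<in> measurable M (S \<Otimes>\<^sub>M G)" by (rule measurable_Pair[OF X Y])
  have eq: "?P \<Otimes>\<^sub>M ?Q = distr M (S \<Otimes>\<^sub>M G) (\<lambda>\<omega>. (X \<omega>, \<omega>))"
  proof (rule pair_measure_eqI)
    show "sigma_finite_measure ?P" "sigma_finite_measure ?Q" by unfold_locales
    show "sets (?P \<Otimes>\<^sub>M ?Q) = sets (distr M (S \<Otimes>\<^sub>M G) (\<lambda>\<omega>. (X \<omega>, \<omega>)))"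
      unfolding sets_distr by (rule sets_pair_measure_cong) simp_all
    fix A B assume "A \<in> sets ?P" "B \<in> sets ?Q"
    then have A: "A \<in> sets S" and B: "B \<in> sets G" by simp_all
    have BM: "B \<subseteq> space M" using sets.sets_into_space[OF B] sp by simp
    have XA: "X -` A \<inter> space M \<in> sets F" using measurable_sets[OF XF A] sp by simp
    have "emeasure ?P A * emeasure ?Q B = emeasure M (X -` A \<inter> space M) * emeasure M ((\<lambda>\<omega>. \<omega>) -` B \<inter> space M)"
      using emeasure_distr[OF X A] emeasure_distr[OF Y B] by simp
    also have "(\<lambda>\<omega>. \<omega>) -` B \<inter> space M = B" using BM by auto
    also have "emeasure M (X -` A \<inter> space M) * emeasure M B = emeasure M ((X -` A \<inter> space M) \<inter> B)"
      using indep_setD[OF ind XA B] by (simp add: emeasure_eq_measure ennreal_mult)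
    also have "(X -` A \<inter> space M) \<inter> B = (\<lambda>\<omega>. (X \<omega>, \<omega>)) -` (A \<times> B) \<inter> space M" by auto
    also have "emeasure M \<dots> = emeasure (distr M (S \<Otimes>\<^sub>M G) (\<lambda>\<omega>. (X \<omega>, \<omega>))) (A \<times> B)"
      by (rule emeasure_distr[OF XY pair_measureI[OF A B], symmetric])
    finally show "emeasure ?P A * emeasure ?Q B = emeasure (distr M (S \<Otimes>\<^sub>M G) (\<lambda>\<omega>. (X \<omega>, \<omega>))) (A \<times> B)" .
  qed
  have f': "f \<in> borel_measurable (?P \<Otimes>\<^sub>M ?Q)"
    using f by (simp cong: measurable_cong_sets sets_pair_measure_cong)
  have "(\<integral>\<^sup>+\<omega>. f (X \<omega>, \<omega>) \<partial>M) = (\<integral>\<^sup>+p. f p \<partial>(?P \<Otimes>\<^sub>M ?Q))"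
    unfolding eq by (rule nn_integral_distr[symmetric, OF XY]) (simp add: f)
  also have "\<dots> = (\<integral>\<^sup>+x. \<integral>\<^sup>+y. f (x, y) \<partial>?Q \<partial>?P)"
    by (rule Q.nn_integral_fst[symmetric, OF f'])
  also have "\<dots> = (\<integral>\<^sup>+\<omega>. \<integral>\<^sup>+y. f (X \<omega>, y) \<partial>?Q \<partial>M)"
    using Q.borel_measurable_nn_integral_fst[OF f'] by (intro nn_integral_distr[OF X]) simp
  also have "\<dots> = (\<integral>\<^sup>+\<omega>. \<integral>\<^sup>+\<omega>'. f (X \<omega>, \<omega>') \<partial>M \<partial>M)"
    using measurable_Pair2[OF f] measurable_space[OF X]
    by (intro nn_integral_cong nn_integral_distr[OF Y]) simp
  finally show ?thesis .
qed

lemma indep_set_trivial_sigma: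
  assumes F: "subalgebra M F"
  shows "indep_set (sets (sigma (space M) {})) (sets F)"
proof -
  have "prob (space M \<inter> b) = prob (space M) * prob b" if "b \<in> sets F" for b
  proof -
    have "b \<in> events" using F that by (auto simp: subalgebra_def)
    then show ?thesis by (simp add: prob_space)
  qed
  then show ?thesis
    unfolding indep_sets2_eq using F by (auto simp: subalgebra_def sigma_sets_empty_eq)
qed

text \<open>
  Freezing \<open>\<tau>\<close> reduces the tail estimate to fixed times. With \<open>(m + 1) ^ 4\<close> scales and threshold
  \<open>\<epsilon> / (m + 1)\<close> the tail probabilities are of order \<open>1 / (m + 1)\<^sup>2\<close>, hence summable. Deterministic times are
  included through the trivial \<open>\<sigma>\<close>-algebra (\<open>indep_set_trivial_sigma\<close>).
\<close>

lemma scale_averages_vanish_at_independent_time: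
  assumes X: "std_brownian_motion M X" and ind: "indep_set (sets F) (sets (process_sigma M X))"
    and F: "space F = space M" and \<tau>F: "\<tau> \<in> borel_measurable F" and pos: "AE \<omega> in M. 0 < \<tau> \<omega>" and s: "fine_scales s" and \<epsilon>: "0 < \<epsilon>"
  shows "AE \<omega> in M. eventually (\<lambda>m. \<bar>scale_average (\<lambda>u. path_eval X u \<omega>) (Suc m ^ 4) (s m) (\<tau> \<omega>)\<bar> < \<epsilon> / real (Suc m)) sequentially"
proof -
  have Xm: "X t \<in> borel_measurable M" if "0 \<le> t" for t
    using X that by (auto simp: std_brownian_motion_def)
  have sub: "subalgebra M (process_sigma M X)" by (rule subalgebra_process_sigma[OF Xm])
  have "subalgebra M F" using indep_setD_ev1[OF ind] F by (simp add: subalgebra_def)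
  then have \<tau>: "\<tau> \<in> borel_measurable M" using \<tau>F by (rule measurable_from_subalg)
  let ?S = "\<lambda>m t \<omega>. scale_average (\<lambda>u. path_eval X u \<omega>) (Suc m ^ 4) (s m) t"
  let ?R = "\<lambda>m t \<omega>. 2 * (1 / 4 ^ m) \<le> t \<and> \<epsilon> / real (Suc m) \<le> \<bar>?S m t \<omega>\<bar>"
  have SF: "(\<lambda>p. ?S m (fst p) (snd p)) \<in> borel_measurable (borel \<Otimes>\<^sub>M process_sigma M X)" for m
    by (rule measurable_scale_average[OF measurable_process_sigma])
  have SM: "(\<lambda>p. ?S m (fst p) (snd p)) \<in> borel_measurable (borel \<Otimes>\<^sub>M M)" for m
    by (rule measurable_scale_average[OF Xm])
  have S\<tau>[measurable]: "(\<lambda>\<omega>. ?S m (\<tau> \<omega>) \<omega>) \<in> borel_measurable M" for m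
    using measurable_compose[OF measurable_Pair[OF \<tau> measurable_ident] SM] by simp
  have St: "(\<lambda>\<omega>. ?S m t \<omega>) \<in> borel_measurable M" for m t
    using measurable_compose[OF measurable_Pair[OF measurable_const measurable_ident] SM, of t] by simp
  note \<tau>[measurable]
  have tail: "prob {\<omega> \<in> space M. ?R m t \<omega>} \<le> (5 / \<epsilon>\<^sup>2) / (real (Suc m))\<^sup>2" for m t
  proof (cases "2 * (1 / 4 ^ m) \<le> t")
    case True
    have "prob {\<omega> \<in> space M. \<epsilon> / real (Suc m) \<le> \<bar>?S m t \<omega>\<bar>} \<le> 5 / (real (Suc m ^ 4) * (\<epsilon> / real (Suc m))\<^sup>2)"
      using s \<epsilon> by (intro scale_average_tail[OF X _ _ _ _ True]) (simp_all add: fine_scales_def)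
    also have "\<dots> = (5 / \<epsilon>\<^sup>2) / (real (Suc m))\<^sup>2"
    proof -
      have "5 / (x ^ 4 * (\<epsilon> / x)\<^sup>2) = (5 / \<epsilon>\<^sup>2) / x\<^sup>2" if "0 < x" for x :: real
        using that \<epsilon> by (simp add: field_simps eval_nat_numeral)
      from this[of "real (Suc m)"] show ?thesis unfolding of_nat_power by simp
    qed
    finally show ?thesis using True by (simp only: simp_thms)
  next
    case False
    then show ?thesis using \<epsilon> by (simp only: simp_thms) simp
  qed
  have "prob {\<omega> \<in> space M. ?R m (\<tau> \<omega>) \<omega>} \<le> (5 / \<epsilon>\<^sup>2) / (real (Suc m))\<^sup>2" for m
  proof -
    have Rset: "{\<omega> \<in> space M. ?R m t \<omega>} \<in> events" for t using St[of m t] by measurable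
    let ?f = "\<lambda>p. indicator {(t, \<omega>). ?R m t \<omega>} p :: ennreal"
    have f: "?f \<in> borel_measurable (borel \<Otimes>\<^sub>M process_sigma M X)"
      using SF[of m] unfolding indicator_def case_prod_beta mem_Collect_eq by measurable
    have "emeasure M {\<omega> \<in> space M. ?R m (\<tau> \<omega>) \<omega>} = (\<integral>\<^sup>+\<omega>. indicator {\<omega> \<in> space M. ?R m (\<tau> \<omega>) \<omega>} \<omega> \<partial>M)"
      by (rule nn_integral_indicator[symmetric]) measurable
    also have "\<dots> = (\<integral>\<^sup>+\<omega>. ?f (\<tau> \<omega>, \<omega>) \<partial>M)"
      by (rule nn_integral_cong) (simp add: indicator_def)
    also have "\<dots> = (\<integral>\<^sup>+\<omega>. \<integral>\<^sup>+\<omega>'. ?f (\<tau> \<omega>, \<omega>') \<partial>M \<partial>M)"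
      by (rule nn_integral_indep_sigma[OF ind F space_process_sigma \<tau>F f])
    also have "\<dots> = (\<integral>\<^sup>+\<omega>. emeasure M {\<omega>' \<in> space M. ?R m (\<tau> \<omega>) \<omega>'} \<partial>M)"
      by (rule nn_integral_cong) (rule nn_integral_indicator_section, rule Rset)
    also have "\<dots> \<le> (\<integral>\<^sup>+\<omega>. ennreal ((5 / \<epsilon>\<^sup>2) / (real (Suc m))\<^sup>2) \<partial>M)"
      unfolding emeasure_eq_measure by (intro nn_integral_mono ennreal_leI tail)
    also have "\<dots> = ennreal ((5 / \<epsilon>\<^sup>2) / (real (Suc m))\<^sup>2)"
      by (simp add: emeasure_space_1)
    finally show ?thesis by (simp add: emeasure_eq_measure ennreal_le_iff)
  qed
  then have "AE \<omega> in M. eventually (\<lambda>m. \<not> ?R m (\<tau> \<omega>) \<omega>) sequentially"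
    by (intro AE_eventually_not_of_summable_bound) measurable
  then show ?thesis
    using pos
  proof eventually_elim
    case (elim \<omega>)
    show ?case using elim(1) eventually_scale_le[OF elim(2)] by eventually_elim (auto simp: not_le)
  qed
qed

text \<open>
  The scales are chosen by \<open>exists_scale_away_from_level\<close> so that each has probability of order
  \<open>1 / (m + 1)\<^sup>2\<close> of being bad. By Markov's inequality at least half of the scales in the \<open>m\<close>-th average are good
  except with summable probability. Good scales contribute at most \<open>- 1 / (m + 1)\<close>, and bad ones are
  still nonpositive because the path lies below \<open>b\<close> before the passage.
\<close>

lemma exists_scales_negative_average_at_passage:
  assumes Z: "std_brownian_motion M Z" and Z0: "\<And>\<omega>. \<omega> \<in> space M \<Longrightarrow> Z 0 \<omega> = 0"
    and \<tau>[measurable]: "\<tau> \<in> borel_measurable M" and fp: "AE \<omega> in M. first_passage (\<lambda>t. Z t \<omega>) b (\<tau> \<omega>)"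
    and pos: "AE \<omega> in M. 0 < \<tau> \<omega>"
  shows "\<exists>s. fine_scales s \<and> (AE \<omega> in M. eventually (\<lambda>m.
    scale_average (\<lambda>u. path_eval Z u \<omega>) (Suc m ^ 4) (s m) (\<tau> \<omega>) \<le> - 1 / (2 * real (Suc m))) sequentially)"
proof -
  define p0 where "p0 = measure (density lborel std_normal_density) {1<..}"
  have p0: "0 < p0" unfolding p0_def by (rule std_normal_upper_tail_pos)
  have Zm: "Z t \<in> borel_measurable M" if "0 \<le> t" for t
    using Z that by (auto simp: std_brownian_motion_def)
  have cont: "AE \<omega> in M. continuous_on {0..} (\<lambda>t. Z t \<omega>)" using Z by (simp add: std_brownian_motion_def)
  define r where "r m k = (1 / 4 ^ m) / (4 ^ k :: real)" for m k :: nat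
  \<comment> \<open>The margin is \<open>1 / (m + 1)\<close> times the square root of the largest admissible scale \<open>2 r\<close>.\<close>
  define a where "a m k = sqrt (2 * r m k) / real (Suc m)" for m k
  have r: "0 < r m k" for m k by (simp add: r_def)
  have a: "0 < a m k" for m k using r by (simp add: a_def)
  let ?B = "\<lambda>s m k \<omega>. s \<le> \<tau> \<omega> \<and> b - path_eval Z (\<tau> \<omega> - s) \<omega> \<le> a m k"
  have ex: "\<exists>s. r m k \<le> s \<and> s \<le> 2 * r m k \<and> prob {\<omega> \<in> space M. ?B s m k \<omega>} \<le> 4 / (p0 * (real (Suc m))\<^sup>2)" for m k
  proof -
    have "2 * (a m k)\<^sup>2 / (p0 * r m k) = 4 / (p0 * (real (Suc m))\<^sup>2)"
      using p0 r[of m k] less_imp_le[OF r[of m k]] unfolding a_def power_divide by simp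
    with exists_scale_away_from_level[OF Z Z0 \<tau> fp a r, of m k m k] show ?thesis
      unfolding p0_def[symmetric] by simp
  qed
  define s where "s m k = (SOME s. r m k \<le> s \<and> s \<le> 2 * r m k \<and> prob {\<omega> \<in> space M. ?B s m k \<omega>} \<le> 4 / (p0 * (real (Suc m))\<^sup>2))"
    for m k
  have "r m k \<le> s m k \<and> s m k \<le> 2 * r m k \<and> prob {\<omega> \<in> space M. ?B (s m k) m k \<omega>} \<le> 4 / (p0 * (real (Suc m))\<^sup>2)" for m k
    unfolding s_def by (rule someI_ex[OF ex])
  then have s: "r m k \<le> s m k" "s m k \<le> 2 * r m k"
    and bad: "prob {\<omega> \<in> space M. ?B (s m k) m k \<omega>} \<le> 4 / (p0 * (real (Suc m))\<^sup>2)" for m k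
    by blast+
  have fine: "fine_scales s"
    unfolding fine_scales_def using s by (simp add: r_def)
  have Bset: "{\<omega> \<in> space M. ?B (s m k) m k \<omega>} \<in> events" for m k
  proof -
    have [measurable]: "(\<lambda>\<omega>. path_eval Z (\<tau> \<omega> - s m k) \<omega>) \<in> borel_measurable M"
      using measurable_compose[OF _ measurable_path_eval[OF Zm], of "\<lambda>\<omega>. (\<tau> \<omega> - s m k, \<omega>)" M] by simp
    show ?thesis by measurable
  qed
  \<comment> \<open>The number of bad scales in the \<open>m\<close>-th average.\<close>
  define C where "C m \<omega> = (\<Sum>k<Suc m ^ 4. indicator {\<omega> \<in> space M. ?B (s m k) m k \<omega>} \<omega> :: real)" for m \<omega>
  have Cint: "integrable M (C m)" for m
    unfolding C_def[abs_def] using Bset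
    by (intro Bochner_Integration.integrable_sum integrable_real_indicator) (simp_all add: emeasure_eq_measure)
  have Cm[measurable]: "C m \<in> borel_measurable M" for m using Cint by (rule borel_measurable_integrable)
  have count: "prob {\<omega> \<in> space M. real (Suc m ^ 4) / 2 \<le> C m \<omega>} \<le> (8 / p0) / (real (Suc m))\<^sup>2" for m
  proof -
    have N: "0 < real (Suc m ^ 4)" by simp
    have "expectation (C m) = (\<Sum>k<Suc m ^ 4. prob {\<omega> \<in> space M. ?B (s m k) m k \<omega>})"
      unfolding C_def[abs_def] using Bset
      by (subst Bochner_Integration.integral_sum) (auto intro!: integrable_real_indicator simp: emeasure_eq_measure)
    also have "\<dots> \<le> (\<Sum>k<Suc m ^ 4. 4 / (p0 * (real (Suc m))\<^sup>2))" by (intro sum_mono bad)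
    also have "\<dots> = real (Suc m ^ 4) * (4 / (p0 * (real (Suc m))\<^sup>2))" by simp
    finally have E: "expectation (C m) \<le> real (Suc m ^ 4) * (4 / (p0 * (real (Suc m))\<^sup>2))" .
    have "prob {\<omega> \<in> space M. real (Suc m ^ 4) / 2 \<le> C m \<omega>} \<le> expectation (C m) / (real (Suc m ^ 4) / 2)"
    proof (rule integral_Markov_inequality_measure[where A="{}" and u="C m", OF Cint])
      have "0 \<le> C m \<omega>" for \<omega> unfolding C_def by (intro sum_nonneg) simp
      then show "AE \<omega> in M. 0 \<le> C m \<omega>" by (intro AE_I2)
    qed (use N in simp_all)
    also have "\<dots> \<le> real (Suc m ^ 4) * (4 / (p0 * (real (Suc m))\<^sup>2)) / (real (Suc m ^ 4) / 2)"
      using E N by (intro divide_right_mono) simp_all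
    also have "\<dots> = (8 / p0) / (real (Suc m))\<^sup>2" using N by (simp del: of_nat_Suc of_nat_power)
    finally show ?thesis .
  qed
  have "AE \<omega> in M. eventually (\<lambda>m. \<not> real (Suc m ^ 4) / 2 \<le> C m \<omega>) sequentially"
    using count by (intro AE_eventually_not_of_summable_bound) measurable
  then have "AE \<omega> in M. eventually (\<lambda>m.
    scale_average (\<lambda>u. path_eval Z u \<omega>) (Suc m ^ 4) (s m) (\<tau> \<omega>) \<le> - 1 / (2 * real (Suc m))) sequentially"
    using pos cont fp AE_space
  proof eventually_elim
    case (elim \<omega>)
    show ?case
      using elim(1) eventually_scale_le[OF elim(2)]
    proof eventually_elim
      case (elim m)
      note few = elim(1) and \<tau>m = elim(2)
      note c = \<open>continuous_on {0..} (\<lambda>t. Z t \<omega>)\<close> and f = \<open>first_passage (\<lambda>t. Z t \<omega>) b (\<tau> \<omega>)\<close>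
        and \<omega> = \<open>\<omega> \<in> space M\<close>
      let ?\<delta> = "1 / real (Suc m)" and ?N = "Suc m ^ 4"
      have term_le: "(path_eval Z (\<tau> \<omega> - s m k) \<omega> - path_eval Z (\<tau> \<omega>) \<omega>) / sqrt (s m k)
        \<le> ?\<delta> * indicator {\<omega> \<in> space M. ?B (s m k) m k \<omega>} \<omega> - ?\<delta>" for k
      proof -
        have sp: "0 < s m k" and st: "s m k \<le> \<tau> \<omega>"
          using fine_scales_pos[OF fine] order_trans[OF fine_scales_le[OF fine] \<tau>m] by auto
        have e: "path_eval Z (\<tau> \<omega> - s m k) \<omega> = Z (\<tau> \<omega> - s m k) \<omega>" "path_eval Z (\<tau> \<omega>) \<omega> = b"
          using path_eval_eq[where X=Z, OF c, of "\<tau> \<omega> - s m k"] path_eval_eq[where X=Z, OF c, of "\<tau> \<omega>"] st sp f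
          by (simp_all add: first_passage_def)
        have below: "Z (\<tau> \<omega> - s m k) \<omega> < b" using f st sp by (simp add: first_passage_def)
        show ?thesis
        proof (cases "?B (s m k) m k \<omega>")
          case True
          then have "?\<delta> * indicator {\<omega> \<in> space M. ?B (s m k) m k \<omega>} \<omega> - ?\<delta> = 0" using \<omega> by simp
          moreover have "(Z (\<tau> \<omega> - s m k) \<omega> - b) / sqrt (s m k) \<le> 0"
            using below sp by (simp add: divide_nonpos_pos)
          ultimately show ?thesis unfolding e by simp
        next
          case False
          then have "a m k < b - Z (\<tau> \<omega> - s m k) \<omega>" using st unfolding e by simp
          moreover have "?\<delta> * sqrt (s m k) \<le> a m k"
            using s(2)[of m k] by (simp add: a_def divide_right_mono)
          ultimately have "Z (\<tau> \<omega> - s m k) \<omega> - b \<le> - ?\<delta> * sqrt (s m k)" by linarith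
          then have "(Z (\<tau> \<omega> - s m k) \<omega> - b) / sqrt (s m k) \<le> - ?\<delta>"
            using sp by (subst pos_divide_le_eq) auto
          moreover have "indicator {\<omega> \<in> space M. ?B (s m k) m k \<omega>} \<omega> = (0 :: real)" 
            using False by (simp add: indicator_def)
          ultimately show ?thesis unfolding e by simp
        qed
      qed
      have "scale_average (\<lambda>u. path_eval Z u \<omega>) ?N (s m) (\<tau> \<omega>)
        \<le> (\<Sum>k<?N. ?\<delta> * indicator {\<omega> \<in> space M. ?B (s m k) m k \<omega>} \<omega> - ?\<delta>) / real ?N"
        unfolding scale_average_def by (intro divide_right_mono sum_mono term_le) simp
      also have "(\<Sum>k<?N. ?\<delta> * indicator {\<omega> \<in> space M. ?B (s m k) m k \<omega>} \<omega> - ?\<delta>) = ?\<delta> * C m \<omega> - ?\<delta> * real ?N"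
        unfolding C_def sum_subtractf sum_distrib_left[symmetric] by simp
      also have "(?\<delta> * C m \<omega> - ?\<delta> * real ?N) / real ?N \<le> (?\<delta> * (real ?N / 2) - ?\<delta> * real ?N) / real ?N"
        using few by (intro divide_right_mono diff_right_mono mult_left_mono) auto
      also have "\<dots> = - 1 / (2 * real (Suc m))"
      proof -
        have "(d * (n / 2) - d * n) / n = - (d / 2)" if "0 < n" for d n :: real
          using that by (simp add: field_simps)
        from this[of "real ?N" ?\<delta>] show ?thesis by simp
      qed
      finally show ?case .
    qed
  qed
  with fine show ?thesis by blast
qed

end

section \<open>Singularity of the conditional law\<close>

theorem theorem3p1:
  fixes M :: "'a measure"
    and B W :: "real \<Rightarrow> 'a \<Rightarrow> real"
    and \<sigma> c :: real
    and D :: "'a \<Rightarrow> real measure"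
  assumes "prob_space M"
    and "std_brownian_motion M B"
    and "std_brownian_motion M W"
    and "indep_processes M B W"
    and "\<sigma> > 0" and "c > 0"
    and "regular_cond_distr M (process_sigma M W) (hitting_time B W c \<sigma>) D"
  shows "AE \<omega> in M. mutually_singular (D \<omega>) lborel"
proof -
  interpret prob_space M by fact
  note B = assms(2) and W = assms(3) and BW = assms(4) and \<sigma> = assms(5) and c = assms(6) and D = assms(7)
  let ?F = "process_sigma M W"
  define \<kappa> where "\<kappa> = sqrt (1 + \<sigma>\<^sup>2)"
  have \<kappa>: "0 < \<kappa>" "\<kappa> * \<kappa> = 1 + \<sigma> * \<sigma>" by (auto simp: \<kappa>_def add_pos_nonneg power2_eq_square)
  define Y where "Y = rotated_sum \<sigma> B W"
  define Z where "Z = rotated_diff \<sigma> B W"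
  have Y: "std_brownian_motion M Y" and Z: "std_brownian_motion M Z"
    unfolding Y_def Z_def by (rule std_brownian_motion_rotated[OF B W BW])+
  have YZ: "indep_processes M Y Z"
    unfolding Y_def Z_def by (rule indep_processes_rotated[OF B W BW])
  have Z0: "Z 0 \<omega> = 0" for \<omega> by (simp add: Z_def rotated_diff_def)
  have W_eq: "W t \<omega> = W 0 \<omega> + (Y t \<omega> - \<sigma> * Z t \<omega>) / \<kappa>" for t \<omega>
  proof -
    have "(Y t \<omega> - \<sigma> * Z t \<omega>) / \<kappa> = ((1 + \<sigma> * \<sigma>) * (W t \<omega> - W 0 \<omega>)) / (\<kappa> * \<kappa>)"
      unfolding Y_def Z_def rotated_sum_def rotated_diff_def \<kappa>_def[symmetric]
      using \<kappa>(1) by (simp add: field_simps)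
    then show ?thesis unfolding \<kappa>(2)[symmetric] using \<kappa>(1) by simp
  qed
  have contW: "AE \<omega> in M. continuous_on {0..} (\<lambda>t. W t \<omega>)"
    and contY: "AE \<omega> in M. continuous_on {0..} (\<lambda>t. Y t \<omega>)"
    and contZ: "AE \<omega> in M. continuous_on {0..} (\<lambda>t. Z t \<omega>)"
    and B0: "AE \<omega> in M. B 0 \<omega> = 0" and W0: "AE \<omega> in M. W 0 \<omega> = 0"
    using B W Y Z by (simp_all add: std_brownian_motion_def)
  have Wm: "W t \<in> borel_measurable M" if "0 \<le> t" for t
    using W that by (auto simp: std_brownian_motion_def)

  define b where "b = c / \<kappa>"
  have b: "0 < b" using c \<kappa>(1) by (simp add: b_def)
  let ?T = "hitting_time B W c \<sigma>"
  define \<tau> where "\<tau> \<omega> = real_of_ereal (?T \<omega>)" for \<omega>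
  have "?T \<in> borel_measurable M" using D by (simp add: regular_cond_distr_def)
  then have \<tau>m: "\<tau> \<in> borel_measurable M" unfolding \<tau>_def[abs_def] by measurable
  have T_fin: "AE \<omega> in M. \<bar>?T \<omega>\<bar> \<noteq> \<infinity>" by (rule regular_cond_distr_finite[OF D])
  have T\<tau>: "AE \<omega> in M. ?T \<omega> = ereal (\<tau> \<omega>)"
    using T_fin by eventually_elim (simp add: \<tau>_def ereal_real)
  have "AE \<omega> in M. first_passage (\<lambda>t. Z t \<omega>) b (\<tau> \<omega>) \<and> 0 < \<tau> \<omega>"
    using T_fin contZ B0 W0
  proof eventually_elim
    case (elim \<omega>)
    have "B t \<omega> = c + \<sigma> * W t \<omega> \<longleftrightarrow> Z t \<omega> = b" for t
      using \<kappa>(1) elim(3,4) unfolding Z_def rotated_diff_def b_def \<kappa>_def[symmetric] by (auto simp: field_simps)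
    then have T: "?T \<omega> = Inf {ereal t |t. 0 \<le> t \<and> Z t \<omega> = b}"
      unfolding hitting_time_def by simp
    have "Z 0 \<omega> < b" using b by (simp add: Z0)
    from first_passage_Inf[OF elim(2) this elim(1)[unfolded T]] show ?case
      unfolding \<tau>_def T by simp
  qed
  then have fp: "AE \<omega> in M. first_passage (\<lambda>t. Z t \<omega>) b (\<tau> \<omega>)" and \<tau>_pos: "AE \<omega> in M. 0 < \<tau> \<omega>"
    by simp_all

  obtain s where s: "fine_scales s" and avgZ: "AE \<omega> in M. eventually (\<lambda>m.
      scale_average (\<lambda>u. path_eval Z u \<omega>) (Suc m ^ 4) (s m) (\<tau> \<omega>) \<le> - 1 / (2 * real (Suc m))) sequentially"
    using exists_scales_negative_average_at_passage[OF Z Z0 \<tau>m fp \<tau>_pos] by blast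

  have avgY: "AE \<omega> in M. eventually (\<lambda>m.
      \<bar>scale_average (\<lambda>u. path_eval Y u \<omega>) (Suc m ^ 4) (s m) (\<tau> \<omega>)\<bar> < (\<sigma> / 4) / real (Suc m)) sequentially"
  proof -
    obtain \<tau>' where \<tau>': "\<tau>' \<in> borel_measurable (process_sigma M Z)" "AE \<omega> in M. \<tau>' \<omega> = \<tau> \<omega>"
      using first_passage_version[OF Z fp] by (rule bexE)
    have "AE \<omega> in M. 0 < \<tau>' \<omega>" using \<tau>'(2) \<tau>_pos by eventually_elim simp
    moreover have "indep_set (sets (process_sigma M Z)) (sets (process_sigma M Y))"
      using YZ unfolding indep_processes_def by (rule indep_set_commute)
    ultimately have "AE \<omega> in M. eventually (\<lambda>m.
      \<bar>scale_average (\<lambda>u. path_eval Y u \<omega>) (Suc m ^ 4) (s m) (\<tau>' \<omega>)\<bar> < (\<sigma> / 4) / real (Suc m)) sequentially"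
      using \<sigma> by (intro scale_averages_vanish_at_independent_time[OF Y _ space_process_sigma \<tau>'(1) _ s]) simp_all
    then show ?thesis using \<tau>'(2) by eventually_elim simp
  qed

  \<comment> \<open>At \<open>\<tau>\<close> the \<open>Z\<close> part contributes at least \<open>\<sigma> / (2 \<kappa> (m + 1))\<close>, and the \<open>Y\<close> part takes away at most half of it.\<close>
  define \<epsilon> where "\<epsilon> = \<sigma> / (4 * \<kappa>)"
  have \<epsilon>: "0 < \<epsilon>" using \<sigma> \<kappa>(1) by (simp add: \<epsilon>_def)
  define S where "S m t \<omega> = scale_average (\<lambda>u. path_eval W u \<omega>) (Suc m ^ 4) (s m) t" for m t \<omega>
  \<comment> \<open>Membership depends on the path of \<open>W\<close> alone and is jointly measurable.\<close>
  define atypical where "atypical t \<omega> \<longleftrightarrow> 0 < t \<and> (\<exists>n. \<forall>m\<ge>n. \<epsilon> / real (Suc m) \<le> S m t \<omega>)" for t \<omega>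

  have at_\<tau>: "AE \<omega> in M. atypical (\<tau> \<omega>) \<omega>"
    using avgZ avgY \<tau>_pos contW contY contZ
  proof eventually_elim
    case (elim \<omega>)
    have "eventually (\<lambda>m. \<epsilon> / real (Suc m) \<le> S m (\<tau> \<omega>) \<omega>) sequentially"
      using elim(1) elim(2) eventually_scale_le[OF elim(3)]
    proof eventually_elim
      case (elim m)
      note cont = \<open>continuous_on {0..} (\<lambda>t. W t \<omega>)\<close> \<open>continuous_on {0..} (\<lambda>t. Y t \<omega>)\<close> \<open>continuous_on {0..} (\<lambda>t. Z t \<omega>)\<close>
        and pos = \<open>0 < \<tau> \<omega>\<close>
      let ?AY = "scale_average (\<lambda>u. path_eval Y u \<omega>) (Suc m ^ 4) (s m) (\<tau> \<omega>)"
      let ?AZ = "scale_average (\<lambda>u. path_eval Z u \<omega>) (Suc m ^ 4) (s m) (\<tau> \<omega>)"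
      have "S m (\<tau> \<omega>) \<omega> = scale_average (\<lambda>u. W 0 \<omega> + (path_eval Y u \<omega> - \<sigma> * path_eval Z u \<omega>) / \<kappa>) (Suc m ^ 4) (s m) (\<tau> \<omega>)"
        unfolding S_def
      proof (rule scale_average_cong)
        fix u :: real assume u: "0 \<le> u"
        show "path_eval W u \<omega> = W 0 \<omega> + (path_eval Y u \<omega> - \<sigma> * path_eval Z u \<omega>) / \<kappa>"
          unfolding path_eval_eq[where X=W, OF cont(1) u] path_eval_eq[where X=Y, OF cont(2) u]
            path_eval_eq[where X=Z, OF cont(3) u] by (rule W_eq)
      next
        fix k show "s m k \<le> \<tau> \<omega>" using fine_scales_le[OF s] elim(3) by (rule order_trans)
      qed (use pos in simp)
      also have "\<dots> = (?AY - \<sigma> * ?AZ) / \<kappa>" by (rule scale_average_affine)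
      finally have S: "S m (\<tau> \<omega>) \<omega> = (?AY - \<sigma> * ?AZ) / \<kappa>" .
      have "- (\<sigma> / 4 / real (Suc m)) \<le> ?AY" using elim(2) by linarith
      moreover have "\<sigma> * ?AZ \<le> \<sigma> * (- 1 / (2 * real (Suc m)))"
        using elim(1) \<sigma> by (intro mult_left_mono) auto
      ultimately have "- (\<sigma> / 4 / real (Suc m)) - \<sigma> * (- 1 / (2 * real (Suc m))) \<le> ?AY - \<sigma> * ?AZ" by linarith
      moreover have "- (\<sigma> / 4 / n) - \<sigma> * (- 1 / (2 * n)) = \<sigma> / 4 / n" if "0 < n" for n
        using that by (simp add: field_simps)
      from this[of "real (Suc m)"]
      have "- (\<sigma> / 4 / real (Suc m)) - \<sigma> * (- 1 / (2 * real (Suc m))) = \<sigma> / 4 / real (Suc m)" by simp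
      ultimately have "(\<sigma> / 4 / real (Suc m)) / \<kappa> \<le> S m (\<tau> \<omega>) \<omega>"
        unfolding S using \<kappa>(1) by (intro divide_right_mono) simp_all
      moreover have "\<sigma> / 4 / n / \<kappa> = \<epsilon> / n" for n by (simp add: \<epsilon>_def)
      ultimately show ?case by (simp only:)
    qed
    then show ?case unfolding atypical_def eventually_sequentially using elim(3) by simp
  qed

  have at_t: "AE \<omega> in M. \<not> atypical t \<omega>" for t
  proof (cases "0 < t")
    case True
    have sub: "subalgebra M ?F" by (rule subalgebra_process_sigma[OF Wm])
    have "AE \<omega> in M. eventually (\<lambda>m. \<bar>S m t \<omega>\<bar> < \<epsilon> / real (Suc m)) sequentially"
      unfolding S_def
      by (rule scale_averages_vanish_at_independent_time[OF W indep_set_trivial_sigma[OF sub] _ _ _ s \<epsilon>])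
        (use True in \<open>simp_all\<close>)
    then show ?thesis
    proof eventually_elim
      case (elim \<omega>)
      then obtain n where n: "\<And>m. n \<le> m \<Longrightarrow> \<bar>S m t \<omega>\<bar> < \<epsilon> / real (Suc m)"
        unfolding eventually_sequentially by blast
      show ?case
      proof
        assume "atypical t \<omega>"
        then obtain n' where "\<And>m. n' \<le> m \<Longrightarrow> \<epsilon> / real (Suc m) \<le> S m t \<omega>"
          unfolding atypical_def by blast
        from this[of "max n n'"] n[of "max n n'"] show False by linarith
      qed
    qed
  qed (simp add: atypical_def)

  have pred_at: "Measurable.pred (borel \<Otimes>\<^sub>M G) (\<lambda>p. atypical (fst p) (snd p))"
    if G: "\<And>t. 0 \<le> t \<Longrightarrow> W t \<in> borel_measurable G" for G
  proof -
    have [measurable]: "(\<lambda>p. S m (fst p) (snd p)) \<in> borel_measurable (borel \<Otimes>\<^sub>M G)" for m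
      unfolding S_def by (rule measurable_scale_average[OF G])
    show ?thesis unfolding atypical_def by measurable
  qed

  have full: "AE \<omega> in M. AE t in D \<omega>. atypical t \<omega>"
  proof -
    have "(\<lambda>p. (snd p, fst p)) \<in> measurable (?F \<Otimes>\<^sub>M borel) (borel \<Otimes>\<^sub>M ?F)" by measurable
    from measurable_compose[OF this pred_at[OF measurable_process_sigma]]
    have P: "Measurable.pred (?F \<Otimes>\<^sub>M borel) (\<lambda>p. atypical (snd p) (fst p))" by simp
    have "AE \<omega> in M. AE t in D \<omega>. (\<lambda>p. atypical (snd p) (fst p)) (\<omega>, t)"
      by (rule AE_regular_cond_distr[OF D \<tau>m T\<tau> P]) (use at_\<tau> in simp)
    then show ?thesis by simp
  qed

  have null: "AE \<omega> in M. AE t in lborel. \<not> atypical t \<omega>"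
  proof -
    interpret LM: pair_sigma_finite lborel M ..
    have "Measurable.pred (lborel \<Otimes>\<^sub>M M) (\<lambda>p. atypical (fst p) (snd p))"
      using pred_at[OF Wm] by (simp cong: measurable_cong_sets sets_pair_measure_cong)
    then have "{p \<in> space (lborel \<Otimes>\<^sub>M M). \<not> atypical (fst p) (snd p)} \<in> sets (lborel \<Otimes>\<^sub>M M)"
      by measurable
    from LM.AE_commute[OF this] show ?thesis using at_t by simp
  qed

  have D_borel: "sets (D \<omega>) = sets borel" "space (D \<omega>) = UNIV" if "\<omega> \<in> space M" for \<omega>
  proof -
    have "D \<in> measurable ?F (prob_algebra borel)" using D by (simp add: regular_cond_distr_def)
    moreover have "\<omega> \<in> space ?F" using that by (simp only: space_process_sigma)
    ultimately have "D \<omega> \<in> space (prob_algebra borel)" by (rule measurable_space)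
    then show "sets (D \<omega>) = sets borel" "space (D \<omega>) = UNIV"
      by (auto simp: space_prob_algebra dest: sets_eq_imp_space_eq)
  qed

  show ?thesis
    using full null AE_space
  proof eventually_elim
    case (elim \<omega>)
    let ?A = "{t. atypical t \<omega>}"
    have "(\<lambda>t. (t, \<omega>)) \<in> measurable borel (borel \<Otimes>\<^sub>M M)" using elim(3) by measurable
    from measurable_compose[OF this pred_at[OF Wm]] have A: "?A \<in> sets borel" by (simp add: pred_def)
    have cA: "UNIV - ?A \<in> sets borel" using sets.compl_sets[OF A] by (simp only: space_borel)
    have "AE t in D \<omega>. t \<notin> UNIV - ?A" using elim(1) by eventually_elim simp
    moreover have "UNIV - ?A \<in> sets (D \<omega>)" unfolding D_borel(1)[OF elim(3)] by (rule cA)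
    ultimately have "UNIV - ?A \<in> null_sets (D \<omega>)" by (simp only: AE_iff_null_sets)
    then have "emeasure (D \<omega>) (UNIV - ?A) = 0" by (rule null_setsD1)
    moreover have "emeasure lborel ?A = 0"
    proof -
      have "AE t in lborel. t \<notin> ?A" using elim(2) by eventually_elim simp
      moreover have "?A \<in> sets lborel" unfolding sets_lborel by (rule A)
      ultimately have "?A \<in> null_sets lborel" by (simp only: AE_iff_null_sets)
      then show ?thesis by (rule null_setsD1)
    qed
    ultimately show ?case unfolding mutually_singular_def using A by blast
  qed
qed

end
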